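(* An inductive rule class $\mathbf{K}$ of Gödel algebras is inductively complete if and only if it is minimal (with respect to inclusion) among non-empty inductive rule classes of Gödel algebras.
   Context: Gödel algebras are Heyting algebras satisfying $(x\to y)\vee(y\to x)=1$ (algebras of $\mathsf{LC}=\mathsf{IPC}+(p\to q)\vee(q\to p)$). A $\forall$-subalgebra of $\mathcal{B}$ is a subalgebra $\mathcal{A}$ such that for every equation $\phi(\overline x,\overline y)$ and tuple $\overline a$ in $A$, $\mathcal{A}\vDash\forall\overline x\phi(\overline x,\overline a)$ implies $\mathcal{B}\vDash\forall\overline x\phi(\overline x,\overline a)$. An inductive rule class is a class closed under isomorphic copies of $\forall$-subalgebras, direct products and ultraproducts. A $\Pi_2$-rule $\Gamma/^2\psi$ (finite premises $\Gamma$ in $\overline p,\overline q$, conclusion $\psi$ in $\overline p$, bound variables $\overline q$) is valid in an algebra iff it satisfies $\forall\overline y(\forall\overline x(\bigwedge\Gamma(\overline x,\overline y)\approx1)\to\psi(\overline y)\approx1)$. $\Pi_2(\mathbf{K})$ is the set of $\Pi_2$-rules valid in all members of $\mathbf{K}$; it is a $\Pi_2$-rule system (a set of $\Pi_2$-rules closed under Strong Reflexivity, Monotonicity, $\alpha$-renaming, Rule cut and Bound Structurality). A rule $R$ is admissible in $\mathbf{K}$ if for every formula $\chi$, $\emptyset/^2\chi\in\Pi_2(\mathbf{K})\oplus R$ implies $\emptyset/^2\chi\in\Pi_2(\mathbf{K})$, where $\Pi_2(\mathbf{K})\oplus R$ is the smallest $\Pi_2$-rule system containing $\Pi_2(\mathbf{K})\cup\{R\}$.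 $\mathbf{K}$ is inductively complete if every $\Pi_2$-rule admissible in $\mathbf{K}$ belongs to $\Pi_2(\mathbf{K})$.
   Formalization: Algebras are nondegenerate (0≠1), products are over non-empty families and K is non-empty, since with one-element algebras or the empty class the equivalence fails; a class is represented by its members on an arbitrary fixed infinite carrier set. *)

theory Defs
  imports Main "HOL-Library.FuncSet"
begin

section \<open>Heyting algebras and Goedel algebras\<close>

record 'a heyting =
  carr :: "'a set"
  meet :: "'a \<Rightarrow> 'a \<Rightarrow> 'a"
  join :: "'a \<Rightarrow> 'a \<Rightarrow> 'a"
  impl :: "'a \<Rightarrow> 'a \<Rightarrow> 'a"
  zero :: 'a
  one :: 'a

definition le :: "'a heyting \<Rightarrow> 'a \<Rightarrow> 'a \<Rightarrow> bool" where
  "le A x y \<longleftrightarrow> meet A x y = x"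

definition heyting_algebra :: "'a heyting \<Rightarrow> bool" where
  "heyting_algebra A \<longleftrightarrow>
     zero A \<in> carr A \<and> one A \<in> carr A \<and>
     (\<forall>x\<in>carr A. \<forall>y\<in>carr A.
        meet A x y \<in> carr A \<and> join A x y \<in> carr A \<and> impl A x y \<in> carr A) \<and>
     (\<forall>x\<in>carr A. \<forall>y\<in>carr A. meet A x y = meet A y x \<and> join A x y = join A y x) \<and>
     (\<forall>x\<in>carr A. \<forall>y\<in>carr A. \<forall>z\<in>carr A.
        meet A (meet A x y) z = meet A x (meet A y z) \<and>
        join A (join A x y) z = join A x (join A y z)) \<and>
     (\<forall>x\<in>carr A. \<forall>y\<in>carr A. meet A x (join A x y) = x \<and> join A x (meet A x y) = x) \<and>
     (\<forall>x\<in>carr A. le A (zero A) x \<and> le A x (one A)) \<and>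
     (\<forall>x\<in>carr A. \<forall>y\<in>carr A. \<forall>z\<in>carr A. le A (meet A x y) z \<longleftrightarrow> le A x (impl A y z))"

definition godel_algebra :: "'a heyting \<Rightarrow> bool" where
  "godel_algebra A \<longleftrightarrow> heyting_algebra A \<and>
     (\<forall>x\<in>carr A. \<forall>y\<in>carr A. join A (impl A x y) (impl A y x) = one A)"

definition nondegenerate :: "'a heyting \<Rightarrow> bool" where
  "nondegenerate A \<longleftrightarrow> zero A \<noteq> one A"


section \<open>Formulas, equations and their evaluation\<close>

datatype fm = Var nat | Bot | Top | And fm fm | Or fm fm | Imp fm fm

primrec vars :: "fm \<Rightarrow> nat set" where
  "vars (Var i) = {i}"
| "vars Bot = {}"
| "vars Top = {}"
| "vars (And \<phi> \<psi>) = vars \<phi> \<union> vars \<psi>"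
| "vars (Or \<phi> \<psi>) = vars \<phi> \<union> vars \<psi>"
| "vars (Imp \<phi> \<psi>) = vars \<phi> \<union> vars \<psi>"

primrec subst :: "(nat \<Rightarrow> fm) \<Rightarrow> fm \<Rightarrow> fm" where
  "subst \<sigma> (Var i) = \<sigma> i"
| "subst \<sigma> Bot = Bot"
| "subst \<sigma> Top = Top"
| "subst \<sigma> (And \<phi> \<psi>) = And (subst \<sigma> \<phi>) (subst \<sigma> \<psi>)"
| "subst \<sigma> (Or \<phi> \<psi>) = Or (subst \<sigma> \<phi>) (subst \<sigma> \<psi>)"
| "subst \<sigma> (Imp \<phi> \<psi>) = Imp (subst \<sigma> \<phi>) (subst \<sigma> \<psi>)"

primrec eval :: "'a heyting \<Rightarrow> (nat \<Rightarrow> 'a) \<Rightarrow> fm \<Rightarrow> 'a" where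
  "eval A v (Var i) = v i"
| "eval A v Bot = zero A"
| "eval A v Top = one A"
| "eval A v (And \<phi> \<psi>) = meet A (eval A v \<phi>) (eval A v \<psi>)"
| "eval A v (Or \<phi> \<psi>) = join A (eval A v \<phi>) (eval A v \<psi>)"
| "eval A v (Imp \<phi> \<psi>) = impl A (eval A v \<phi>) (eval A v \<psi>)"

definition valuations :: "'a heyting \<Rightarrow> (nat \<Rightarrow> 'a) set" where
  "valuations A = {v. \<forall>i. v i \<in> carr A}"

text \<open>The valuations obtained from \<open>v\<close> by reassigning the variables in \<open>X\<close>; quantifying over
  them interprets a universal quantifier over the tuple of variables \<open>X\<close>.\<close>

definition variants :: "'a heyting \<Rightarrow> nat set \<Rightarrow> (nat \<Rightarrow> 'a) \<Rightarrow> (nat \<Rightarrow> 'a) set" where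
  "variants A X v = {w \<in> valuations A. \<forall>i. i \<notin> X \<longrightarrow> w i = v i}"

definition sat_all_eq :: "'a heyting \<Rightarrow> nat set \<Rightarrow> (nat \<Rightarrow> 'a) \<Rightarrow> fm \<Rightarrow> fm \<Rightarrow> bool" where
  "sat_all_eq A X v s t \<longleftrightarrow> (\<forall>w\<in>variants A X v. eval A w s = eval A w t)"



section \<open>Constructions on algebras\<close>

definition subalgebra :: "'a heyting \<Rightarrow> 'a heyting \<Rightarrow> bool" where
  "subalgebra A B \<longleftrightarrow> heyting_algebra A \<and> heyting_algebra B \<and> carr A \<subseteq> carr B \<and>
     zero A = zero B \<and> one A = one B \<and>
     (\<forall>x\<in>carr A. \<forall>y\<in>carr A.
        meet A x y = meet B x y \<and> join A x y = join B x y \<and> impl A x y = impl B x y)"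

definition forall_subalgebra :: "'a heyting \<Rightarrow> 'a heyting \<Rightarrow> bool" where
  "forall_subalgebra A B \<longleftrightarrow> subalgebra A B \<and>
     (\<forall>s t X. \<forall>v\<in>valuations A. finite X \<longrightarrow> sat_all_eq A X v s t \<longrightarrow> sat_all_eq B X v s t)"

definition isomorphic :: "'a heyting \<Rightarrow> 'b heyting \<Rightarrow> bool" where
  "isomorphic A B \<longleftrightarrow> (\<exists>h. bij_betw h (carr A) (carr B) \<and>
     h (zero A) = zero B \<and> h (one A) = one B \<and>
     (\<forall>x\<in>carr A. \<forall>y\<in>carr A.
        h (meet A x y) = meet B (h x) (h y) \<and>
        h (join A x y) = join B (h x) (h y) \<and>
        h (impl A x y) = impl B (h x) (h y)))"

definition copy_of_forall_subalgebra :: "'a heyting \<Rightarrow> 'b heyting \<Rightarrow> bool" where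
  "copy_of_forall_subalgebra A B \<longleftrightarrow>
     heyting_algebra A \<and> (\<exists>C. forall_subalgebra C B \<and> isomorphic A C)"

definition direct_product :: "'i set \<Rightarrow> ('i \<Rightarrow> 'a heyting) \<Rightarrow> ('i \<Rightarrow> 'a) heyting" where
  "direct_product I A =
    \<lparr> carr = (\<Pi>\<^sub>E i\<in>I. carr (A i)),
      meet = (\<lambda>f g. \<lambda>i\<in>I. meet (A i) (f i) (g i)),
      join = (\<lambda>f g. \<lambda>i\<in>I. join (A i) (f i) (g i)),
      impl = (\<lambda>f g. \<lambda>i\<in>I. impl (A i) (f i) (g i)),
      zero = (\<lambda>i\<in>I. zero (A i)),
      one = (\<lambda>i\<in>I. one (A i)) \<rparr>"

definition ultrafilter_on :: "'i set \<Rightarrow> 'i set set \<Rightarrow> bool" where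
  "ultrafilter_on I U \<longleftrightarrow> U \<subseteq> Pow I \<and> I \<in> U \<and> {} \<notin> U \<and>
     (\<forall>X\<in>U. \<forall>Y\<in>U. X \<inter> Y \<in> U) \<and>
     (\<forall>X\<in>U. \<forall>Y. X \<subseteq> Y \<and> Y \<subseteq> I \<longrightarrow> Y \<in> U) \<and>
     (\<forall>X. X \<subseteq> I \<longrightarrow> X \<in> U \<or> I - X \<in> U)"

definition ultra_rel ::
    "'i set \<Rightarrow> 'i set set \<Rightarrow> ('i \<Rightarrow> 'a heyting) \<Rightarrow> (('i \<Rightarrow> 'a) \<times> ('i \<Rightarrow> 'a)) set" where
  "ultra_rel I U A =
     {(f, g). f \<in> carr (direct_product I A) \<and> g \<in> carr (direct_product I A) \<and>
              {i \<in> I. f i = g i} \<in> U}"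

definition ultraproduct ::
    "'i set \<Rightarrow> 'i set set \<Rightarrow> ('i \<Rightarrow> 'a heyting) \<Rightarrow> ('i \<Rightarrow> 'a) set heyting" where
  "ultraproduct I U A = (let P = direct_product I A; r = ultra_rel I U A in
    \<lparr> carr = carr P // r,
      meet = (\<lambda>F G. r `` {meet P f g | f g. f \<in> F \<and> g \<in> G}),
      join = (\<lambda>F G. r `` {join P f g | f g. f \<in> F \<and> g \<in> G}),
      impl = (\<lambda>F G. r `` {impl P f g | f g. f \<in> F \<and> g \<in> G}),
      zero = r `` {zero P},
      one = r `` {one P} \<rparr>)"


section \<open>Inductive rule classes\<close>

text \<open>
  A class is represented by the set of its members whose carrier is contained in a fixed infinite
  type \<^typ>\<open>'a\<close>; index sets of products and ultraproducts range over the subsets of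
  a type \<^typ>\<open>'i\<close> at least as large as \<^typ>\<open>'a\<close>. A product or
  ultraproduct need not fit into \<^typ>\<open>'a\<close>, so closure under products and
  ultraproducts is expressed through the isomorphic copies of their \<open>\<forall>\<close>-subalgebras (among them
  the products and ultraproducts themselves). By the downward Loewenheim-Skolem theorem these
  members determine the class.

  Algebras are nondegenerate, and accordingly products are over non-empty families: the one-element
  algebra validates every rule, so the class of one-element algebras would otherwise be the only
  minimal non-empty class, although other classes are inductively complete.
\<close>

definition inductive_rule_class :: "'i itself \<Rightarrow> 'a heyting set \<Rightarrow> bool" where
  "inductive_rule_class _ K \<longleftrightarrow>
     (\<forall>A\<in>K. godel_algebra A \<and> nondegenerate A) \<and>
     (\<forall>A\<in>K. \<forall>B. copy_of_forall_subalgebra B A \<longrightarrow> B \<in> K) \<and>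
     (\<forall>(I :: 'i set) A B. I \<noteq> {} \<longrightarrow> (\<forall>i\<in>I. A i \<in> K) \<longrightarrow>
        copy_of_forall_subalgebra B (direct_product I A) \<longrightarrow> B \<in> K) \<and>
     (\<forall>(I :: 'i set) U A B. ultrafilter_on I U \<longrightarrow> (\<forall>i\<in>I. A i \<in> K) \<longrightarrow>
        copy_of_forall_subalgebra B (ultraproduct I U A) \<longrightarrow> B \<in> K)"


section \<open>\<open>\<Pi>\<^sub>2\<close>-rules\<close>

text \<open>The triple \<open>(\<Gamma>, Q, \<psi>)\<close> stands for the rule with premises \<open>\<Gamma>\<close>, bound variables \<open>Q\<close> and
  conclusion \<open>\<psi>\<close>.\<close>

type_synonym pi2_rule = "fm set \<times> nat set \<times> fm"

definition pi2_rules :: "pi2_rule set" where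
  "pi2_rules = {(\<Gamma>, Q, \<psi>). finite \<Gamma> \<and> finite Q \<and> vars \<psi> \<inter> Q = {}}"

definition valid :: "'a heyting \<Rightarrow> pi2_rule \<Rightarrow> bool" where
  "valid A = (\<lambda>(\<Gamma>, Q, \<psi>). \<forall>v\<in>valuations A.
     (\<forall>w\<in>variants A Q v. \<forall>\<gamma>\<in>\<Gamma>. eval A w \<gamma> = one A) \<longrightarrow> eval A v \<psi> = one A)"

definition Pi2 :: "'a heyting set \<Rightarrow> pi2_rule set" where
  "Pi2 K = {R \<in> pi2_rules. \<forall>A\<in>K. valid A R}"

text \<open>Strong reflexivity: a premise yields each of its instances obtained by substituting formulas
  without bound variables for the bound variables.\<close>

definition strong_reflexivity :: "pi2_rule set \<Rightarrow> bool" where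
  "strong_reflexivity S \<longleftrightarrow>
     (\<forall>\<Gamma> Q \<phi> \<sigma>. \<phi> \<in> \<Gamma> \<longrightarrow> (\<forall>i. i \<notin> Q \<longrightarrow> \<sigma> i = Var i) \<longrightarrow>
        (\<Gamma>, Q, subst \<sigma> \<phi>) \<in> pi2_rules \<longrightarrow> (\<Gamma>, Q, subst \<sigma> \<phi>) \<in> S)"

definition monotonicity :: "pi2_rule set \<Rightarrow> bool" where
  "monotonicity S \<longleftrightarrow>
     (\<forall>\<Gamma> Q \<psi> \<Gamma>' Q'. (\<Gamma>, Q, \<psi>) \<in> S \<longrightarrow> \<Gamma> \<subseteq> \<Gamma>' \<longrightarrow> Q \<subseteq> Q' \<longrightarrow>
        (\<Gamma>', Q', \<psi>) \<in> pi2_rules \<longrightarrow> (\<Gamma>', Q', \<psi>) \<in> S)"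

definition alpha_renaming :: "pi2_rule set \<Rightarrow> bool" where
  "alpha_renaming S \<longleftrightarrow>
     (\<forall>\<Gamma> Q \<psi> f. (\<Gamma>, Q, \<psi>) \<in> S \<longrightarrow> inj_on f Q \<longrightarrow>
        f ` Q \<inter> ((\<Union>\<gamma>\<in>\<Gamma>. vars \<gamma>) - Q) = {} \<longrightarrow> f ` Q \<inter> vars \<psi> = {} \<longrightarrow>
        (subst (\<lambda>i. Var (if i \<in> Q then f i else i)) ` \<Gamma>, f ` Q, \<psi>) \<in> S)"

text \<open>Rule cut: if the bound variables \<open>Q'\<close> of a rule with premises \<open>\<Delta>\<close> are not free in \<open>\<Gamma>\<close>, then
  deriving every member of \<open>\<Delta>\<close> from \<open>\<Gamma>\<close> amounts to deriving it for all values of \<open>Q'\<close>.\<close>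

definition rule_cut :: "pi2_rule set \<Rightarrow> bool" where
  "rule_cut S \<longleftrightarrow>
     (\<forall>\<Gamma> Q \<Delta> Q' \<psi>. (\<forall>\<delta>\<in>\<Delta>. (\<Gamma>, Q, \<delta>) \<in> S) \<longrightarrow> (\<Delta>, Q', \<psi>) \<in> S \<longrightarrow>
        Q' \<inter> ((\<Union>\<gamma>\<in>\<Gamma>. vars \<gamma>) - Q) = {} \<longrightarrow>
        (\<Gamma>, Q, \<psi>) \<in> pi2_rules \<longrightarrow> (\<Gamma>, Q, \<psi>) \<in> S)"

text \<open>Bound structurality: closure under substitutions that fix the bound variables and do not
  capture any variable.\<close>

definition bound_structurality :: "pi2_rule set \<Rightarrow> bool" where
  "bound_structurality S \<longleftrightarrow>
     (\<forall>\<Gamma> Q \<psi> \<sigma>. (\<Gamma>, Q, \<psi>) \<in> S \<longrightarrow> (\<forall>i\<in>Q. \<sigma> i = Var i) \<longrightarrow>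
        (\<forall>i. i \<notin> Q \<longrightarrow> vars (\<sigma> i) \<inter> Q = {}) \<longrightarrow>
        (subst \<sigma> ` \<Gamma>, Q, subst \<sigma> \<psi>) \<in> S)"

definition pi2_rule_system :: "pi2_rule set \<Rightarrow> bool" where
  "pi2_rule_system S \<longleftrightarrow> S \<subseteq> pi2_rules \<and> strong_reflexivity S \<and> monotonicity S \<and>
     alpha_renaming S \<and> rule_cut S \<and> bound_structurality S"

definition oplus :: "pi2_rule set \<Rightarrow> pi2_rule \<Rightarrow> pi2_rule set" where
  "oplus S R = \<Inter>{S'. pi2_rule_system S' \<and> S \<union> {R} \<subseteq> S'}"

definition admissible :: "'a heyting set \<Rightarrow> pi2_rule \<Rightarrow> bool" where
  "admissible K R \<longleftrightarrow> (\<forall>\<chi>. ({}, {}, \<chi>) \<in> oplus (Pi2 K) R \<longrightarrow> ({}, {}, \<chi>) \<in> Pi2 K)"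

definition inductively_complete :: "'a heyting set \<Rightarrow> bool" where
  "inductively_complete K \<longleftrightarrow> (\<forall>R\<in>pi2_rules. admissible K R \<longrightarrow> R \<in> Pi2 K)"

end

theory Submission
  imports Defs "HOL-Library.Countable"
begin

text \<open>
  An inductive rule class contains every nondegenerate Heyting algebra that validates its
  \<open>\<Pi>\<^sub>2\<close>-rules. A rule failing in the algebra fails in the class, so each finite part of the diagram
  of the algebra has a model in the class: finite products refute several formulas at once. An
  ultraproduct of these models has the algebra as a \<open>\<forall>\<close>-subalgebra.

  If \<^term>\<open>K\<close> is minimal and the rule \<open>R\<close> is admissible, the members of \<^term>\<open>K\<close> that
  validate \<open>R\<close> form an inductive rule class. It is non-empty because it contains the Lindenbaum
  algebra of \<open>\<Pi>\<^sub>2(K) \<oplus> R\<close>, which is nondegenerate by admissibility.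

  If \<^term>\<open>K\<close> is inductively complete, all members of \<^term>\<open>K\<close> satisfy the same equations,
  so every rule valid in a non-empty inductive subclass is admissible in \<^term>\<open>K\<close>, hence valid in
  \<^term>\<open>K\<close>, and the subclass is all of \<^term>\<open>K\<close>.
\<close>

section \<open>Formulas and their evaluation\<close>

lemma finite_vars [simp]: "finite (vars \<phi>)"
  by (induction \<phi>) auto

lemma vars_subst: "vars (subst \<sigma> \<phi>) = (\<Union>i\<in>vars \<phi>. vars (\<sigma> i))"
  by (induction \<phi>) auto

lemma subst_cong: "(\<And>i. i \<in> vars \<phi> \<Longrightarrow> \<sigma> i = \<tau> i) \<Longrightarrow> subst \<sigma> \<phi> = subst \<tau> \<phi>"
  by (induction \<phi>) auto

lemma subst_Var [simp]: "subst Var \<phi> = \<phi>"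
  by (induction \<phi>) auto

lemma subst_subst: "subst \<sigma> (subst \<tau> \<phi>) = subst (\<lambda>i. subst \<sigma> (\<tau> i)) \<phi>"
  by (induction \<phi>) auto

lemma eval_cong: "(\<And>i. i \<in> vars \<phi> \<Longrightarrow> v i = w i) \<Longrightarrow> eval A v \<phi> = eval A w \<phi>"
  by (induction \<phi>) auto

lemma eval_subst: "eval A v (subst \<sigma> \<phi>) = eval A (\<lambda>i. eval A v (\<sigma> i)) \<phi>"
  by (induction \<phi>) auto

definition closed_under_operations :: "'a heyting \<Rightarrow> bool" where
  "closed_under_operations A \<longleftrightarrow> zero A \<in> carr A \<and> one A \<in> carr A \<and>
     (\<forall>x\<in>carr A. \<forall>y\<in>carr A.
        meet A x y \<in> carr A \<and> join A x y \<in> carr A \<and> impl A x y \<in> carr A)"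

lemma operations_closed [simp]:
  assumes "closed_under_operations A"
  shows "zero A \<in> carr A" "one A \<in> carr A"
    "x \<in> carr A \<Longrightarrow> y \<in> carr A \<Longrightarrow> meet A x y \<in> carr A"
    "x \<in> carr A \<Longrightarrow> y \<in> carr A \<Longrightarrow> join A x y \<in> carr A"
    "x \<in> carr A \<Longrightarrow> y \<in> carr A \<Longrightarrow> impl A x y \<in> carr A"
  using assms by (auto simp: closed_under_operations_def)

lemma heyting_algebra_closed [simp]: "heyting_algebra A \<Longrightarrow> closed_under_operations A"
  unfolding heyting_algebra_def closed_under_operations_def by blast

lemma valuations_iff: "v \<in> valuations A \<longleftrightarrow> (\<forall>i. v i \<in> carr A)"
  by (simp add: valuations_def)

lemma valuations_carr [simp]: "v \<in> valuations A \<Longrightarrow> v i \<in> carr A"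
  by (simp add: valuations_iff)

lemma eval_closed [simp]:
  "closed_under_operations A \<Longrightarrow> v \<in> valuations A \<Longrightarrow> eval A v \<phi> \<in> carr A"
  by (induction \<phi>) auto

lemma variants_iff:
  "w \<in> variants A X v \<longleftrightarrow> w \<in> valuations A \<and> (\<forall>i. i \<notin> X \<longrightarrow> w i = v i)"
  by (simp add: variants_def)

lemma variants_empty [simp]: "v \<in> valuations A \<Longrightarrow> variants A {} v = {v}"
  by (auto simp: variants_iff fun_eq_iff)

section \<open>Heyting algebras\<close>

lemma heyting_comm:
  assumes "heyting_algebra A" "x \<in> carr A" "y \<in> carr A"
  shows "meet A x y = meet A y x" "join A x y = join A y x"
  using assms unfolding heyting_algebra_def by auto

lemma heyting_assoc:
  assumes "heyting_algebra A" "x \<in> carr A" "y \<in> carr A" "z \<in> carr A"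
  shows "meet A (meet A x y) z = meet A x (meet A y z)"
    "join A (join A x y) z = join A x (join A y z)"
  using assms unfolding heyting_algebra_def by auto

lemma heyting_absorb:
  assumes "heyting_algebra A" "x \<in> carr A" "y \<in> carr A"
  shows "meet A x (join A x y) = x" "join A x (meet A x y) = x"
  using assms unfolding heyting_algebra_def by auto

lemma heyting_bounds:
  assumes "heyting_algebra A" "x \<in> carr A"
  shows "meet A (zero A) x = zero A" "meet A x (one A) = x"
  using assms unfolding heyting_algebra_def le_def by auto

lemma heyting_residuation:
  assumes "heyting_algebra A" "x \<in> carr A" "y \<in> carr A" "z \<in> carr A"
  shows "meet A (meet A x y) z = meet A x y \<longleftrightarrow> meet A x (impl A y z) = x"
  using assms unfolding heyting_algebra_def le_def by auto

lemma heyting_idem: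
  assumes "heyting_algebra A" "x \<in> carr A"
  shows "meet A x x = x"
  using heyting_absorb(1)[OF assms, of "meet A x x"] heyting_absorb(2)[OF assms, of x] assms by simp

lemma heyting_meet_eq_one_iff:
  assumes A: "heyting_algebra A" and x: "x \<in> carr A" and y: "y \<in> carr A"
  shows "meet A x y = one A \<longleftrightarrow> x = one A \<and> y = one A"
proof -
  have "meet A x (meet A x y) = meet A x y" "meet A (meet A x y) y = meet A x y"
    using heyting_assoc(1)[OF A x x y, symmetric] heyting_assoc(1)[OF A x y y] A x y
    by (simp_all add: heyting_idem)
  then show ?thesis
    using heyting_bounds(2)[OF A] heyting_comm(1)[OF A] A x y
    by metis
qed

lemma heyting_impl_eq_one_iff:
  assumes A: "heyting_algebra A" and x: "x \<in> carr A" and y: "y \<in> carr A"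
  shows "impl A x y = one A \<longleftrightarrow> meet A x y = x"
proof -
  have "meet A (one A) z = z" if "z \<in> carr A" for z
    using heyting_bounds(2)[OF A that] heyting_comm(1)[OF A that, of "one A"] A by simp
  then show ?thesis
    using heyting_residuation[OF A _ x y, of "one A"] A x y by simp
qed

definition Iff :: "fm \<Rightarrow> fm \<Rightarrow> fm" where
  "Iff \<phi> \<psi> = And (Imp \<phi> \<psi>) (Imp \<psi> \<phi>)"

lemma eval_Iff_eq_one:
  assumes "heyting_algebra A" "v \<in> valuations A"
  shows "eval A v (Iff \<phi> \<psi>) = one A \<longleftrightarrow> eval A v \<phi> = eval A v \<psi>"
  using assms heyting_comm(1)[of A "eval A v \<phi>" "eval A v \<psi>"]
  by (auto simp: Iff_def heyting_meet_eq_one_iff heyting_impl_eq_one_iff heyting_idem)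

text \<open>Residuation is not an identity but a pair of quasi-identities.\<close>

definition heyting_quasi_identity ::
    "'a itself \<Rightarrow> fm \<times> fm \<Rightarrow> fm \<times> fm \<Rightarrow> bool" where
  "heyting_quasi_identity _ = (\<lambda>(s, t) (s', t'). \<forall>A :: 'a heyting. heyting_algebra A \<longrightarrow>
     (\<forall>v\<in>valuations A. eval A v s = eval A v t \<longrightarrow> eval A v s' = eval A v t'))"

lemma heyting_quasi_identityD:
  fixes A :: "'a heyting"
  assumes "heyting_quasi_identity TYPE('a) (s, t) (s', t')" "heyting_algebra A" "v \<in> valuations A"
    "eval A v s = eval A v t"
  shows "eval A v s' = eval A v t'"
  using assms by (simp add: heyting_quasi_identity_def)

lemma heyting_algebraI:
  assumes closed: "closed_under_operations B"
    and quasi_identity: "\<And>s t s' t' v. heyting_quasi_identity TYPE('a) (s, t) (s', t') \<Longrightarrow>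
      v \<in> valuations B \<Longrightarrow> eval B v s = eval B v t \<Longrightarrow> eval B v s' = eval B v t'"
  shows "heyting_algebra B"
proof -
  note identity = quasi_identity[of Top Top, simplified]
  let ?x = "Var 0" and ?y = "Var 1" and ?z = "Var 2"
  note [simp] = heyting_quasi_identity_def
  show ?thesis
    unfolding heyting_algebra_def le_def
  proof (intro conjI ballI iffI)
    fix x y z assume xyz: "x \<in> carr B" "y \<in> carr B" "z \<in> carr B"
    let ?v = "(\<lambda>_. z)(0 := x, 1 := y)"
    have v: "?v \<in> valuations B"
      using xyz by (simp add: valuations_iff)
    show "meet B (meet B x y) z = meet B x (meet B y z)"
      "join B (join B x y) z = join B x (join B y z)"
      using identity[of "And (And ?x ?y) ?z" "And ?x (And ?y ?z)" ?v]
        identity[of "Or (Or ?x ?y) ?z" "Or ?x (Or ?y ?z)" ?v] v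
      by (simp_all add: heyting_assoc)
    show "meet B x (impl B y z) = x" if "meet B (meet B x y) z = meet B x y"
      using quasi_identity[of "And (And ?x ?y) ?z" "And ?x ?y" "And ?x (Imp ?y ?z)" ?x ?v]
        v that by (simp add: heyting_residuation)
    show "meet B (meet B x y) z = meet B x y" if "meet B x (impl B y z) = x"
      using quasi_identity[of "And ?x (Imp ?y ?z)" ?x "And (And ?x ?y) ?z" "And ?x ?y" ?v]
        v that by (simp add: heyting_residuation)
  next
    fix x y assume xy: "x \<in> carr B" "y \<in> carr B"
    let ?v = "(\<lambda>_. x)(1 := y)"
    have v: "?v \<in> valuations B"
      using xy by (simp add: valuations_iff)
    show "meet B x y = meet B y x" "join B x y = join B y x"
      using identity[of "And ?x ?y" "And ?y ?x" ?v]
        identity[of "Or ?x ?y" "Or ?y ?x" ?v] v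
      by (simp_all add: heyting_comm)
    show "meet B x (join B x y) = x" "join B x (meet B x y) = x"
      using identity[of "And ?x (Or ?x ?y)" ?x ?v]
        identity[of "Or ?x (And ?x ?y)" ?x ?v] v
      by (simp_all add: heyting_absorb)
  next
    fix x assume x: "x \<in> carr B"
    show "meet B (zero B) x = zero B" "meet B x (one B) = x"
      using identity[of "And Bot ?x" Bot "\<lambda>_. x"] identity[of "And ?x Top" ?x "\<lambda>_. x"]
        x by (simp_all add: heyting_bounds valuations_iff)
  qed (use closed in auto)
qed

section \<open>Homomorphisms\<close>

definition heyting_hom :: "('a \<Rightarrow> 'b) \<Rightarrow> 'a heyting \<Rightarrow> 'b heyting \<Rightarrow> bool" where
  "heyting_hom h A B \<longleftrightarrow> h ` carr A \<subseteq> carr B \<and> h (zero A) = zero B \<and> h (one A) = one B \<and>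
     (\<forall>x\<in>carr A. \<forall>y\<in>carr A.
        h (meet A x y) = meet B (h x) (h y) \<and>
        h (join A x y) = join B (h x) (h y) \<and>
        h (impl A x y) = impl B (h x) (h y))"

lemma heyting_hom_one: "heyting_hom h A B \<Longrightarrow> h (one A) = one B"
  by (simp add: heyting_hom_def)

lemma heyting_hom_valuations: "heyting_hom h A B \<Longrightarrow> v \<in> valuations A \<Longrightarrow> h \<circ> v \<in> valuations B"
  by (auto simp: heyting_hom_def valuations_iff)

lemma valuations_surj:
  assumes "h ` carr A = carr B" "v \<in> valuations B"
  obtains u where "u \<in> valuations A" "h \<circ> u = v"
proof -
  have "\<forall>i. \<exists>x\<in>carr A. h x = v i"
    using assms by (metis imageE valuations_carr)
  then obtain u where "\<forall>i. u i \<in> carr A \<and> h (u i) = v i" by metis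
  then show thesis
    by (intro that[of u]) (auto simp: valuations_iff)
qed

lemma heyting_hom_variants:
  "heyting_hom h A B \<Longrightarrow> w \<in> variants A X v \<Longrightarrow> h \<circ> w \<in> variants B X (h \<circ> v)"
  using heyting_hom_valuations by (force simp: variants_iff)

lemma eval_hom:
  assumes "closed_under_operations A" "heyting_hom h A B" "v \<in> valuations A"
  shows "eval B (h \<circ> v) \<phi> = h (eval A v \<phi>)"
  by (induction \<phi>) (use assms in \<open>auto simp: heyting_hom_def\<close>)

lemma heyting_algebra_of_inj_hom:
  fixes A :: "'a heyting"
  assumes A: "heyting_algebra A" and B: "closed_under_operations B"
    and h: "heyting_hom h B A" "inj_on h (carr B)"
  shows "heyting_algebra B"
proof (rule heyting_algebraI[OF B])
  fix s t s' t' v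
  assume qi: "heyting_quasi_identity TYPE('a) (s, t) (s', t')" and v: "v \<in> valuations B"
    and "eval B v s = eval B v t"
  then have "eval A (h \<circ> v) s = eval A (h \<circ> v) t"
    by (simp add: eval_hom[OF B h(1) v])
  then have "eval A (h \<circ> v) s' = eval A (h \<circ> v) t'"
    by (rule heyting_quasi_identityD[OF qi A heyting_hom_valuations[OF h(1) v]])
  then show "eval B v s' = eval B v t'"
    using h(2) B v by (simp add: eval_hom[OF B h(1) v] inj_on_eq_iff)
qed

lemma isomorphic_iff:
  "isomorphic A B \<longleftrightarrow> (\<exists>h. bij_betw h (carr A) (carr B) \<and> heyting_hom h A B)"
  unfolding isomorphic_def heyting_hom_def bij_betw_def by (intro ex_cong1) auto

lemma isomorphic_copy:
  fixes r :: "'b \<Rightarrow> 'a"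
  assumes B: "heyting_algebra B" and r: "inj_on r (carr B)"
  shows "\<exists>A :: 'a heyting. heyting_algebra A \<and> isomorphic A B"
proof -
  define s where "s = the_inv_into (carr B) r"
  have s_r: "s (r x) = x" if "x \<in> carr B" for x
    using r that by (simp add: s_def the_inv_into_f_f)
  define A where "A = \<lparr>carr = r ` carr B,
      meet = \<lambda>x y. r (meet B (s x) (s y)), join = \<lambda>x y. r (join B (s x) (s y)),
      impl = \<lambda>x y. r (impl B (s x) (s y)), zero = r (zero B), one = r (one B)\<rparr>"
  have bij: "bij_betw s (carr A) (carr B)"
    using s_r by (force simp: A_def bij_betw_def inj_on_def image_iff)
  moreover have hom: "heyting_hom s A B"
    using B by (auto simp: heyting_hom_def A_def s_r)
  moreover have "heyting_algebra A"
  proof (rule heyting_algebra_of_inj_hom[OF B _ hom])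
    show "closed_under_operations A"
      unfolding closed_under_operations_def using B by (auto simp: A_def s_r)
    show "inj_on s (carr A)"
      using bij by (simp add: bij_betw_def)
  qed
  ultimately show ?thesis
    unfolding isomorphic_iff by blast
qed

section \<open>Universal formulas and validity of rules\<close>

definition sat_all :: "'a heyting \<Rightarrow> nat set \<Rightarrow> (nat \<Rightarrow> 'a) \<Rightarrow> fm \<Rightarrow> bool" where
  "sat_all A X v \<phi> \<longleftrightarrow> (\<forall>w\<in>variants A X v. eval A w \<phi> = one A)"

lemma sat_all_empty [simp]: "v \<in> valuations A \<Longrightarrow> sat_all A {} v \<phi> \<longleftrightarrow> eval A v \<phi> = one A"
  by (simp add: sat_all_def)

lemma sat_all_eq_iff_sat_all:
  "heyting_algebra A \<Longrightarrow> sat_all_eq A X v s t \<longleftrightarrow> sat_all A X v (Iff s t)"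
  by (auto simp: sat_all_eq_def sat_all_def variants_iff eval_Iff_eq_one)

lemma sat_all_eq_Top: "sat_all_eq A X v \<phi> Top \<longleftrightarrow> sat_all A X v \<phi>"
  by (simp add: sat_all_eq_def sat_all_def)

lemma sat_all_renameI:
  assumes v: "v \<in> valuations A"
    and bound: "\<And>i. i \<in> vars \<phi> \<Longrightarrow> \<rho> i \<in> Y \<longleftrightarrow> i \<in> X"
    and free: "\<And>i. i \<in> vars \<phi> - X \<Longrightarrow> w (\<rho> i) = v i"
    and sat: "sat_all A X v \<phi>"
  shows "sat_all A Y w (subst (\<lambda>i. Var (\<rho> i)) \<phi>)"
  unfolding sat_all_def
proof
  fix t assume t: "t \<in> variants A Y w"
  define u where "u i = (if i \<in> X then t (\<rho> i) else v i)" for i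
  have "u \<in> variants A X v"
    using t v by (simp add: u_def variants_iff valuations_iff)
  then have "eval A u \<phi> = one A"
    using sat by (simp add: sat_all_def)
  moreover have "u i = t (\<rho> i)" if "i \<in> vars \<phi>" for i
    using that bound free t by (simp add: u_def variants_iff)
  ultimately show "eval A t (subst (\<lambda>i. Var (\<rho> i)) \<phi>) = one A"
    by (simp add: eval_subst cong: eval_cong)
qed

lemma sat_all_renameD:
  assumes w: "w \<in> valuations A"
    and inj: "inj_on \<rho> (vars \<phi> \<inter> X)"
    and bound: "\<And>i. i \<in> vars \<phi> \<Longrightarrow> \<rho> i \<in> Y \<longleftrightarrow> i \<in> X"
    and free: "\<And>i. i \<in> vars \<phi> - X \<Longrightarrow> w (\<rho> i) = v i"
    and sat: "sat_all A Y w (subst (\<lambda>i. Var (\<rho> i)) \<phi>)"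
  shows "sat_all A X v \<phi>"
  unfolding sat_all_def
proof
  fix u assume u: "u \<in> variants A X v"
  let ?Z = "vars \<phi> \<inter> X"
  define t where "t k = (if k \<in> \<rho> ` ?Z then u (the_inv_into ?Z \<rho> k) else w k)" for k
  have "t \<in> variants A Y w"
    using bound u w by (auto simp: t_def variants_iff valuations_iff)
  then have "eval A (\<lambda>i. t (\<rho> i)) \<phi> = one A"
    using sat by (simp add: sat_all_def eval_subst)
  moreover have "t (\<rho> i) = u i" if i: "i \<in> vars \<phi>" for i
  proof (cases "i \<in> X")
    case True
    then show ?thesis
      using i inj by (simp add: t_def the_inv_into_f_f)
  next
    case False
    then have "\<rho> i \<notin> \<rho> ` ?Z"
      using bound i by (metis IntE imageE)
    then show ?thesis
      using False i free[of i] u by (simp add: t_def variants_iff)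
  qed
  ultimately show "eval A u \<phi> = one A"
    by (simp cong: eval_cong)
qed

lemma sat_all_rename:
  assumes "v \<in> valuations A" "w \<in> valuations A" "inj_on \<rho> (vars \<phi> \<inter> X)"
    "\<And>i. i \<in> vars \<phi> \<Longrightarrow> \<rho> i \<in> Y \<longleftrightarrow> i \<in> X" "\<And>i. i \<in> vars \<phi> - X \<Longrightarrow> w (\<rho> i) = v i"
  shows "sat_all A Y w (subst (\<lambda>i. Var (\<rho> i)) \<phi>) \<longleftrightarrow> sat_all A X v \<phi>"
  using sat_all_renameI[OF assms(1,4,5)] sat_all_renameD[OF assms(2-5)] by blast

lemma sat_all_cong:
  assumes "v \<in> valuations A" "w \<in> valuations A" "vars \<phi> \<inter> X = vars \<phi> \<inter> Y"
    "\<And>i. i \<in> vars \<phi> - X \<Longrightarrow> v i = w i"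
  shows "sat_all A X v \<phi> \<longleftrightarrow> sat_all A Y w \<phi>"
  using sat_all_rename[of v A w "\<lambda>i. i" \<phi> X Y] assms by auto

lemma sat_all_bound_cong:
  "v \<in> valuations A \<Longrightarrow> vars \<phi> \<inter> X = vars \<phi> \<inter> Y \<Longrightarrow> sat_all A X v \<phi> \<longleftrightarrow> sat_all A Y v \<phi>"
  by (rule sat_all_cong) auto

lemma sat_all_no_bound:
  "v \<in> valuations A \<Longrightarrow> vars \<phi> \<inter> X = {} \<Longrightarrow> sat_all A X v \<phi> \<longleftrightarrow> eval A v \<phi> = one A"
  using sat_all_bound_cong[of v A \<phi> X "{}"] by simp

definition refutes ::
    "'a heyting \<Rightarrow> (nat \<Rightarrow> 'a) \<Rightarrow> fm set \<Rightarrow> nat set \<Rightarrow> fm set \<Rightarrow> bool" where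
  "refutes A v \<Gamma> Q \<Psi> \<longleftrightarrow> v \<in> valuations A \<and> (\<forall>\<gamma>\<in>\<Gamma>. sat_all A Q v \<gamma>) \<and>
     (\<forall>\<psi>\<in>\<Psi>. eval A v \<psi> \<noteq> one A)"

lemma valid_iff:
  "valid A (\<Gamma>, Q, \<psi>) \<longleftrightarrow>
    (\<forall>v\<in>valuations A. (\<forall>\<gamma>\<in>\<Gamma>. sat_all A Q v \<gamma>) \<longrightarrow> eval A v \<psi> = one A)"
  by (auto simp: valid_def sat_all_def)

lemma valid_iff_not_refutes: "valid A (\<Gamma>, Q, \<psi>) \<longleftrightarrow> (\<nexists>v. refutes A v \<Gamma> Q {\<psi>})"
  by (auto simp: valid_iff refutes_def)

section \<open>Embeddings that preserve universal formulas\<close>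

definition forall_embedding :: "('a \<Rightarrow> 'b) \<Rightarrow> 'a heyting \<Rightarrow> 'b heyting \<Rightarrow> bool" where
  "forall_embedding h A B \<longleftrightarrow> h ` carr A \<subseteq> carr B \<and>
     (\<forall>v\<in>valuations A. \<forall>X \<phi>. finite X \<longrightarrow> sat_all B X (h \<circ> v) \<phi> = sat_all A X v \<phi>)"

lemma forall_embedding_valuations:
  "forall_embedding h A B \<Longrightarrow> v \<in> valuations A \<Longrightarrow> h \<circ> v \<in> valuations B"
  by (auto simp: forall_embedding_def valuations_iff)

lemma forall_embedding_sat_all_iff:
  "forall_embedding h A B \<Longrightarrow> v \<in> valuations A \<Longrightarrow> finite X \<Longrightarrow>
    sat_all B X (h \<circ> v) \<phi> \<longleftrightarrow> sat_all A X v \<phi>"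
  by (simp add: forall_embedding_def)

lemma forall_embedding_eval_eq_one_iff:
  assumes "forall_embedding h A B" "v \<in> valuations A"
  shows "eval B (h \<circ> v) \<phi> = one B \<longleftrightarrow> eval A v \<phi> = one A"
  using forall_embedding_sat_all_iff[OF assms finite.emptyI] forall_embedding_valuations[OF assms]
    assms(2) by simp

lemma forall_embeddingI:
  assumes h: "h ` carr A \<subseteq> carr B"
    and preserves: "\<And>v X \<phi>. v \<in> valuations A \<Longrightarrow> finite X \<Longrightarrow> sat_all A X v \<phi> \<Longrightarrow>
      sat_all B X (h \<circ> v) \<phi>"
    and reflects: "\<And>v \<phi>. v \<in> valuations A \<Longrightarrow> eval B (h \<circ> v) \<phi> = one B \<Longrightarrow> eval A v \<phi> = one A"
  shows "forall_embedding h A B"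
proof -
  have "sat_all A X v \<phi>" if "sat_all B X (h \<circ> v) \<phi>" for v X \<phi>
    unfolding sat_all_def
  proof
    fix w assume w: "w \<in> variants A X v"
    then have "h \<circ> w \<in> variants B X (h \<circ> v)"
      using h by (auto simp: variants_iff valuations_iff)
    then show "eval A w \<phi> = one A"
      using that w by (intro reflects) (simp_all add: sat_all_def variants_iff)
  qed
  then show ?thesis
    using h preserves unfolding forall_embedding_def by blast
qed

lemma refutes_forall_embedding:
  assumes "forall_embedding h A B" "finite Q" "refutes A v \<Gamma> Q \<Psi>"
  shows "refutes B (h \<circ> v) \<Gamma> Q \<Psi>"
  using assms unfolding refutes_def
  by (simp add: forall_embedding_valuations forall_embedding_sat_all_iff
      forall_embedding_eval_eq_one_iff)

lemma valid_forall_embedding: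
  assumes "forall_embedding h A B" "valid B R" "R \<in> pi2_rules"
  shows "valid A R"
  using assms refutes_forall_embedding
  by (cases R) (force simp: valid_iff_not_refutes pi2_rules_def)

lemma isomorphism_sat_all_iff:
  assumes A: "closed_under_operations A" and h: "bij_betw h (carr A) (carr B)" "heyting_hom h A B"
    and v: "v \<in> valuations A"
  shows "sat_all B X (h \<circ> v) \<phi> \<longleftrightarrow> sat_all A X v \<phi>"
proof -
  have eq_iff: "h x = h y \<longleftrightarrow> x = y" if "x \<in> carr A" "y \<in> carr A" for x y
    using h(1) that by (auto simp: bij_betw_def dest: inj_onD)
  have "variants B X (h \<circ> v) = (\<lambda>w. h \<circ> w) ` variants A X v"
  proof (intro subset_antisym subsetI)
    fix w assume w: "w \<in> variants B X (h \<circ> v)"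
    then obtain u where u: "u \<in> valuations A" "h \<circ> u = w"
      using valuations_surj[of h A B w] h(1) by (auto simp: bij_betw_def variants_iff)
    then have "u \<in> variants A X v"
      using w v eq_iff by (auto simp: variants_iff)
    then show "w \<in> (\<lambda>w. h \<circ> w) ` variants A X v"
      using u(2) by blast
  qed (use heyting_hom_variants[OF h(2)] in blast)
  moreover have "eval B (h \<circ> w) \<phi> = one B \<longleftrightarrow> eval A w \<phi> = one A" if "w \<in> variants A X v" for w
    using that A eq_iff[of "eval A w \<phi>" "one A"]
    by (simp add: variants_iff eval_hom[OF A h(2)] heyting_hom_one[OF h(2)])
  ultimately show ?thesis
    by (simp add: sat_all_def)
qed

lemma isomorphism_imp_forall_embedding:
  assumes "closed_under_operations A" "bij_betw h (carr A) (carr B)" "heyting_hom h A B"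
  shows "forall_embedding h A B"
  using isomorphism_sat_all_iff[OF assms] assms(2)
  by (simp add: forall_embedding_def bij_betw_imp_surj_on)

lemma refutes_isomorphic:
  assumes iso: "isomorphic A B" and A: "closed_under_operations A" and B: "refutes B v \<Gamma> Q \<Psi>"
  shows "\<exists>u. refutes A u \<Gamma> Q \<Psi>"
proof -
  obtain h where h: "bij_betw h (carr A) (carr B)" "heyting_hom h A B"
    using iso by (auto simp: isomorphic_iff)
  have v: "v \<in> valuations B"
    using B by (simp add: refutes_def)
  then obtain u where u: "u \<in> valuations A" "h \<circ> u = v"
    using valuations_surj[of h A B v] h(1) by (auto simp: bij_betw_def)
  have sat: "sat_all B X v \<phi> \<longleftrightarrow> sat_all A X u \<phi>" for X \<phi>
    using isomorphism_sat_all_iff[OF A h u(1)] by (simp add: u(2))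
  have "eval B v \<phi> = one B \<longleftrightarrow> eval A u \<phi> = one A" for \<phi>
    using sat[of "{}"] u(1) v by simp
  then have "refutes A u \<Gamma> Q \<Psi>"
    using B u(1) sat by (simp add: refutes_def)
  then show ?thesis by blast
qed

lemma forall_embedding_eval_eq_iff:
  assumes "heyting_algebra A" "heyting_algebra B" "forall_embedding h A B" "v \<in> valuations A"
  shows "eval B (h \<circ> v) s = eval B (h \<circ> v) t \<longleftrightarrow> eval A v s = eval A v t"
  using forall_embedding_eval_eq_one_iff[OF assms(3,4), of "Iff s t"]
    forall_embedding_valuations[OF assms(3,4)] assms
  by (simp add: eval_Iff_eq_one)

lemma forall_embedding_inj_on:
  assumes "heyting_algebra A" "heyting_algebra B" "forall_embedding h A B"
  shows "inj_on h (carr A)"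
proof (rule inj_onI)
  fix x y assume "x \<in> carr A" "y \<in> carr A" "h x = h y"
  then show "x = y"
    using forall_embedding_eval_eq_iff[OF assms, of "(\<lambda>_. x)(1 := y)" "Var 0" "Var 1"]
    by (simp add: valuations_iff)
qed

lemma forall_embedding_hom:
  assumes A: "heyting_algebra A" and B: "heyting_algebra B" and h: "forall_embedding h A B"
  shows "heyting_hom h A B"
proof -
  note eval_eq = forall_embedding_eval_eq_iff[OF assms]
  have "h (meet A x y) = meet B (h x) (h y) \<and> h (join A x y) = join B (h x) (h y) \<and>
      h (impl A x y) = impl B (h x) (h y)" if "x \<in> carr A" "y \<in> carr A" for x y
    using eval_eq[of "(\<lambda>_. meet A x y)(0 := x, 1 := y)" "Var 2" "And (Var 0) (Var 1)"]
      eval_eq[of "(\<lambda>_. join A x y)(0 := x, 1 := y)" "Var 2" "Or (Var 0) (Var 1)"]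
      eval_eq[of "(\<lambda>_. impl A x y)(0 := x, 1 := y)" "Var 2" "Imp (Var 0) (Var 1)"] A that
    by (simp add: valuations_iff)
  moreover have "h (zero A) = zero B \<and> h (one A) = one B"
    using eval_eq[of "\<lambda>_. zero A" "Var 0" Bot] eval_eq[of "\<lambda>_. one A" "Var 0" Top] A
    by (simp add: valuations_iff)
  ultimately show ?thesis
    using h by (simp add: heyting_hom_def forall_embedding_def)
qed

lemma subalgebra_hom_image:
  assumes A: "heyting_algebra A" and B: "heyting_algebra B" and h: "heyting_hom h A B"
  shows "subalgebra (B\<lparr>carr := h ` carr A\<rparr>) B" (is "subalgebra ?C B")
proof -
  have "closed_under_operations ?C"
    unfolding closed_under_operations_def
  proof (intro conjI ballI)
    have "h (zero A) \<in> h ` carr A" "h (one A) \<in> h ` carr A"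
      using A by simp_all
    then show "zero ?C \<in> carr ?C" "one ?C \<in> carr ?C"
      using h by (simp_all add: heyting_hom_def)
    fix x y assume "x \<in> carr ?C" "y \<in> carr ?C"
    then obtain a b where ab: "a \<in> carr A" "b \<in> carr A" "x = h a" "y = h b" by auto
    then have "h (meet A a b) \<in> h ` carr A" "h (join A a b) \<in> h ` carr A"
      "h (impl A a b) \<in> h ` carr A"
      using A by simp_all
    then show "meet ?C x y \<in> carr ?C" "join ?C x y \<in> carr ?C" "impl ?C x y \<in> carr ?C"
      using h ab by (simp_all add: heyting_hom_def)
  qed
  moreover have "heyting_hom id ?C B"
    using h by (simp add: heyting_hom_def)
  ultimately have "heyting_algebra ?C"
    using heyting_algebra_of_inj_hom[OF B, of ?C id] by (simp add: inj_on_def)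
  then show ?thesis
    using B h by (simp add: subalgebra_def heyting_hom_def)
qed

lemma forall_subalgebra_iff:
  "forall_subalgebra A B \<longleftrightarrow> subalgebra A B \<and> forall_embedding id A B"
proof (cases "subalgebra A B")
  case True
  then have A: "heyting_algebra A" and B: "heyting_algebra B" and hom: "heyting_hom id A B"
    by (auto simp: subalgebra_def heyting_hom_def)
  have "(\<forall>s t X. \<forall>v\<in>valuations A. finite X \<longrightarrow> sat_all_eq A X v s t \<longrightarrow> sat_all_eq B X v s t) \<longleftrightarrow>
    forall_embedding id A B"
  proof
    assume preserves:
      "\<forall>s t X. \<forall>v\<in>valuations A. finite X \<longrightarrow> sat_all_eq A X v s t \<longrightarrow> sat_all_eq B X v s t"
    show "forall_embedding id A B"
    proof (rule forall_embeddingI)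
      show "id ` carr A \<subseteq> carr B"
        using hom by (simp add: heyting_hom_def)
      show "sat_all B X (id \<circ> v) \<phi>"
        if "v \<in> valuations A" "finite X" "sat_all A X v \<phi>" for v X \<phi>
        using preserves[rule_format, of v X \<phi> Top] that by (simp add: sat_all_eq_Top)
      show "eval A v \<phi> = one A" if "v \<in> valuations A" "eval B (id \<circ> v) \<phi> = one B" for v \<phi>
        using that A eval_hom[OF _ hom, of v \<phi>] heyting_hom_one[OF hom] by simp
    qed
  qed (use A B forall_embedding_sat_all_iff in \<open>fastforce simp: sat_all_eq_iff_sat_all\<close>)
  then show ?thesis
    by (simp add: forall_subalgebra_def)
qed (simp add: forall_subalgebra_def)

lemma forall_embedding_comp:
  assumes "forall_embedding h A B" "forall_embedding k B C"
  shows "forall_embedding (k \<circ> h) A C"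
  using assms forall_embedding_valuations[OF assms(1)]
  by (fastforce simp: forall_embedding_def comp_assoc)

lemma copy_of_forall_subalgebra_iff:
  assumes B: "heyting_algebra B"
  shows "copy_of_forall_subalgebra A B \<longleftrightarrow> heyting_algebra A \<and> (\<exists>h. forall_embedding h A B)"
proof (intro iffI conjI; (elim conjE exE)?)
  assume copy: "copy_of_forall_subalgebra A B"
  then show A: "heyting_algebra A"
    by (simp add: copy_of_forall_subalgebra_def)
  obtain C h where C: "forall_embedding id C B"
    and h: "bij_betw h (carr A) (carr C)" "heyting_hom h A C"
    using copy by (auto simp: copy_of_forall_subalgebra_def isomorphic_iff forall_subalgebra_iff)
  have "forall_embedding h A C"
    using isomorphism_imp_forall_embedding[OF _ h] A by simp
  then show "\<exists>h. forall_embedding h A B"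
    using forall_embedding_comp C by blast
next
  fix h assume A: "heyting_algebra A" and h: "forall_embedding h A B"
  let ?C = "B\<lparr>carr := h ` carr A\<rparr>"
  have hom: "heyting_hom h A B"
    by (rule forall_embedding_hom[OF A B h])
  then have iso: "bij_betw h (carr A) (carr ?C)" "heyting_hom h A ?C"
    using forall_embedding_inj_on[OF A B h] by (simp_all add: bij_betw_def heyting_hom_def)
  have "forall_embedding id ?C B"
    unfolding forall_embedding_def
  proof (intro conjI ballI allI impI)
    fix v and X :: "nat set" and \<phi> assume v: "v \<in> valuations ?C" and X: "finite X"
    obtain u where u: "u \<in> valuations A" "h \<circ> u = v"
      using valuations_surj[of h A ?C v] v by auto
    show "sat_all B X (id \<circ> v) \<phi> = sat_all ?C X v \<phi>"
      using forall_embedding_sat_all_iff[OF h u(1) X] isomorphism_sat_all_iff[OF _ iso u(1)] A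
      by (simp add: u(2))
  qed (use hom in \<open>simp add: heyting_hom_def\<close>)
  then have "forall_subalgebra ?C B"
    using subalgebra_hom_image[OF A B hom] by (simp add: forall_subalgebra_iff)
  then show "copy_of_forall_subalgebra A B"
    using A iso unfolding copy_of_forall_subalgebra_def isomorphic_iff by blast
qed

lemma valid_copy_of_forall_subalgebra:
  assumes "copy_of_forall_subalgebra B A" "heyting_algebra A" "valid A R" "R \<in> pi2_rules"
  shows "valid B R"
proof -
  obtain h where "forall_embedding h B A"
    using assms(1,2) by (auto simp: copy_of_forall_subalgebra_iff)
  then show ?thesis
    using assms(3,4) by (rule valid_forall_embedding)
qed

section \<open>Rule systems\<close>

lemma valid_strong_reflexivity:
  assumes "closed_under_operations A" "\<phi> \<in> \<Gamma>" "\<And>i. i \<notin> Q \<Longrightarrow> \<sigma> i = Var i"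
  shows "valid A (\<Gamma>, Q, subst \<sigma> \<phi>)"
  unfolding valid_iff
proof (intro ballI impI)
  fix v assume v: "v \<in> valuations A" and "\<forall>\<gamma>\<in>\<Gamma>. sat_all A Q v \<gamma>"
  then have "sat_all A Q v \<phi>"
    using assms(2) by blast
  moreover have "(\<lambda>i. eval A v (\<sigma> i)) \<in> variants A Q v"
    using assms(1,3) v by (auto simp: variants_iff valuations_iff)
  ultimately show "eval A v (subst \<sigma> \<phi>) = one A"
    by (simp add: sat_all_def eval_subst)
qed

lemma valid_monotonicity:
  assumes "valid A (\<Gamma>, Q, \<psi>)" "\<Gamma> \<subseteq> \<Gamma>'" "Q \<subseteq> Q'"
  shows "valid A (\<Gamma>', Q', \<psi>)"
proof -
  have "variants A Q v \<subseteq> variants A Q' v" for v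
    using assms(3) unfolding subset_iff variants_iff by blast
  then have "sat_all A Q v \<phi>" if "sat_all A Q' v \<phi>" for v \<phi>
    using that by (auto simp: sat_all_def)
  then show ?thesis
    using assms(1,2) unfolding valid_iff by blast
qed

lemma valid_alpha_renaming:
  assumes "valid A (\<Gamma>, Q, \<psi>)" "inj_on f Q" "f ` Q \<inter> ((\<Union>\<gamma>\<in>\<Gamma>. vars \<gamma>) - Q) = {}"
  shows "valid A (subst (\<lambda>i. Var (if i \<in> Q then f i else i)) ` \<Gamma>, f ` Q, \<psi>)"
proof -
  have "sat_all A (f ` Q) v (subst (\<lambda>i. Var (if i \<in> Q then f i else i)) \<gamma>) \<longleftrightarrow> sat_all A Q v \<gamma>"
    if "v \<in> valuations A" "\<gamma> \<in> \<Gamma>" for v \<gamma>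
    by (rule sat_all_rename) (use assms(2,3) that in \<open>auto simp: inj_on_def\<close>)
  then show ?thesis
    using assms(1) by (simp add: valid_iff)
qed

lemma valid_rule_cut:
  assumes "\<And>\<delta>. \<delta> \<in> \<Delta> \<Longrightarrow> valid A (\<Gamma>, Q, \<delta>)" "valid A (\<Delta>, Q', \<psi>)"
    "Q' \<inter> ((\<Union>\<gamma>\<in>\<Gamma>. vars \<gamma>) - Q) = {}"
  shows "valid A (\<Gamma>, Q, \<psi>)"
  unfolding valid_iff
proof (intro ballI impI)
  fix v assume v: "v \<in> valuations A" and \<Gamma>: "\<forall>\<gamma>\<in>\<Gamma>. sat_all A Q v \<gamma>"
  have "eval A w \<delta> = one A" if \<delta>: "\<delta> \<in> \<Delta>" and w: "w \<in> variants A Q' v" for \<delta> w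
  proof -
    have "sat_all A Q w \<gamma> \<longleftrightarrow> sat_all A Q v \<gamma>" if "\<gamma> \<in> \<Gamma>" for \<gamma>
      by (rule sat_all_cong) (use assms(3) v w that in \<open>auto simp: variants_iff\<close>)
    then show ?thesis
      using assms(1)[OF \<delta>] w \<Gamma> by (simp add: valid_iff variants_iff)
  qed
  then show "eval A v \<psi> = one A"
    using assms(2) v by (simp add: valid_iff sat_all_def)
qed

lemma sat_all_subst:
  assumes A: "closed_under_operations A" and v: "v \<in> valuations A"
    and bound: "\<And>i. i \<in> Q \<Longrightarrow> \<sigma> i = Var i" and free: "\<And>i. i \<notin> Q \<Longrightarrow> vars (\<sigma> i) \<inter> Q = {}"
    and sat: "sat_all A Q v (subst \<sigma> \<phi>)"
  shows "sat_all A Q (\<lambda>i. eval A v (\<sigma> i)) \<phi>"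
  unfolding sat_all_def
proof
  fix w assume w: "w \<in> variants A Q (\<lambda>i. eval A v (\<sigma> i))"
  define u where "u i = (if i \<in> Q then w i else v i)" for i
  have "u \<in> variants A Q v"
    using w v by (auto simp: variants_iff valuations_iff u_def)
  then have "eval A (\<lambda>i. eval A u (\<sigma> i)) \<phi> = one A"
    using sat by (simp add: sat_all_def eval_subst)
  moreover have "eval A u (\<sigma> i) = w i" for i
  proof (cases "i \<in> Q")
    case True
    then show ?thesis using bound by (simp add: u_def)
  next
    case False
    then have "eval A u (\<sigma> i) = eval A v (\<sigma> i)"
      using free[OF False] by (intro eval_cong) (auto simp: u_def)
    then show ?thesis using w False by (simp add: variants_iff)
  qed
  ultimately show "eval A w \<phi> = one A" by simp
qed

lemma valid_bound_structurality:
  assumes "closed_under_operations A" "valid A (\<Gamma>, Q, \<psi>)" "\<And>i. i \<in> Q \<Longrightarrow> \<sigma> i = Var i"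
    "\<And>i. i \<notin> Q \<Longrightarrow> vars (\<sigma> i) \<inter> Q = {}"
  shows "valid A (subst \<sigma> ` \<Gamma>, Q, subst \<sigma> \<psi>)"
  using assms sat_all_subst[of A _ Q \<sigma>]
  by (auto simp: valid_iff eval_subst valuations_iff[of "\<lambda>i. eval A _ (\<sigma> i)"])

lemma alpha_renaming_Pi2: "alpha_renaming (Pi2 K)"
  unfolding alpha_renaming_def
proof (intro allI impI)
  fix \<Gamma> Q \<psi> f
  assume R: "(\<Gamma>, Q, \<psi>) \<in> Pi2 K" "inj_on f Q" "f ` Q \<inter> (\<Union> (vars ` \<Gamma>) - Q) = {}"
    "f ` Q \<inter> vars \<psi> = {}"
  then have "(subst (\<lambda>i. Var (if i \<in> Q then f i else i)) ` \<Gamma>, f ` Q, \<psi>) \<in> pi2_rules"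
    by (auto simp: Pi2_def pi2_rules_def)
  with R show "(subst (\<lambda>i. Var (if i \<in> Q then f i else i)) ` \<Gamma>, f ` Q, \<psi>) \<in> Pi2 K"
    using valid_alpha_renaming[OF _ R(2,3)] unfolding Pi2_def by blast
qed

lemma rule_cut_Pi2: "rule_cut (Pi2 K)"
  unfolding rule_cut_def
proof (intro allI impI)
  fix \<Gamma> Q \<Delta> Q' \<psi>
  assume R: "\<forall>\<delta>\<in>\<Delta>. (\<Gamma>, Q, \<delta>) \<in> Pi2 K" "(\<Delta>, Q', \<psi>) \<in> Pi2 K"
    "Q' \<inter> (\<Union> (vars ` \<Gamma>) - Q) = {}" "(\<Gamma>, Q, \<psi>) \<in> pi2_rules"
  have "valid A (\<Gamma>, Q, \<psi>)" if "A \<in> K" for A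
    by (rule valid_rule_cut[where \<Delta> = \<Delta>, OF _ _ R(3)]) (use R that in \<open>auto simp: Pi2_def\<close>)
  with R(4) show "(\<Gamma>, Q, \<psi>) \<in> Pi2 K"
    by (simp add: Pi2_def)
qed

lemma bound_structurality_Pi2:
  assumes K: "\<And>A. A \<in> K \<Longrightarrow> closed_under_operations A"
  shows "bound_structurality (Pi2 K)"
  unfolding bound_structurality_def
proof (intro allI impI)
  fix \<Gamma> Q \<psi> \<sigma>
  assume R: "(\<Gamma>, Q, \<psi>) \<in> Pi2 K" "\<forall>i\<in>Q. \<sigma> i = Var i" "\<forall>i. i \<notin> Q \<longrightarrow> vars (\<sigma> i) \<inter> Q = {}"
  then have "(subst \<sigma> ` \<Gamma>, Q, subst \<sigma> \<psi>) \<in> pi2_rules"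
    by (fastforce simp: Pi2_def pi2_rules_def vars_subst)
  moreover have "valid A (subst \<sigma> ` \<Gamma>, Q, subst \<sigma> \<psi>)" if "A \<in> K" for A
    by (rule valid_bound_structurality) (use R K that in \<open>auto simp: Pi2_def\<close>)
  ultimately show "(subst \<sigma> ` \<Gamma>, Q, subst \<sigma> \<psi>) \<in> Pi2 K"
    by (simp add: Pi2_def)
qed

lemma pi2_rule_system_Pi2:
  assumes K: "\<And>A. A \<in> K \<Longrightarrow> closed_under_operations A"
  shows "pi2_rule_system (Pi2 K)"
proof -
  have "strong_reflexivity (Pi2 K)"
    unfolding strong_reflexivity_def Pi2_def using valid_strong_reflexivity K by blast
  moreover have "monotonicity (Pi2 K)"
    unfolding monotonicity_def Pi2_def using valid_monotonicity by blast
  moreover have "bound_structurality (Pi2 K)"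
    using K by (rule bound_structurality_Pi2)
  ultimately show ?thesis
    using alpha_renaming_Pi2 rule_cut_Pi2 by (auto simp: pi2_rule_system_def Pi2_def)
qed

lemma pi2_rule_system_pi2_rules: "pi2_rule_system pi2_rules"
  using pi2_rule_system_Pi2[of "{} :: nat heyting set"] by (simp add: Pi2_def)

lemma pi2_rule_system_Inter:
  assumes systems: "\<And>S. S \<in> \<S> \<Longrightarrow> pi2_rule_system S" and ne: "\<S> \<noteq> {}"
  shows "pi2_rule_system (\<Inter>\<S>)"
  unfolding pi2_rule_system_def
proof (intro conjI)
  show "\<Inter>\<S> \<subseteq> pi2_rules"
    using systems ne unfolding pi2_rule_system_def by blast
  have "\<forall>S\<in>\<S>. strong_reflexivity S"
    using systems by (simp add: pi2_rule_system_def)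
  then show "strong_reflexivity (\<Inter>\<S>)"
    unfolding strong_reflexivity_def Inter_iff by blast
  have "\<forall>S\<in>\<S>. monotonicity S"
    using systems by (simp add: pi2_rule_system_def)
  then show "monotonicity (\<Inter>\<S>)"
    unfolding monotonicity_def Inter_iff by meson
  have "\<forall>S\<in>\<S>. alpha_renaming S"
    using systems by (simp add: pi2_rule_system_def)
  then show "alpha_renaming (\<Inter>\<S>)"
    unfolding alpha_renaming_def Inter_iff by meson
  have "\<forall>S\<in>\<S>. rule_cut S"
    using systems by (simp add: pi2_rule_system_def)
  then show "rule_cut (\<Inter>\<S>)"
    unfolding rule_cut_def Inter_iff by meson
  have "\<forall>S\<in>\<S>. bound_structurality S"
    using systems by (simp add: pi2_rule_system_def)
  then show "bound_structurality (\<Inter>\<S>)"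
    unfolding bound_structurality_def Inter_iff by meson
qed

lemma pi2_rule_system_oplus:
  assumes "S \<subseteq> pi2_rules" "R \<in> pi2_rules"
  shows "pi2_rule_system (oplus S R)"
  unfolding oplus_def using assms pi2_rule_system_pi2_rules by (intro pi2_rule_system_Inter) auto

lemma oplus_superset: "insert R S \<subseteq> oplus S R"
  by (auto simp: oplus_def)

lemma oplus_least: "pi2_rule_system T \<Longrightarrow> insert R S \<subseteq> T \<Longrightarrow> oplus S R \<subseteq> T"
  by (auto simp: oplus_def)

section \<open>Direct products\<close>

lemma carr_direct_product: "carr (direct_product I A) = (\<Pi>\<^sub>E i\<in>I. carr (A i))"
  by (simp add: direct_product_def)

lemma direct_product_component [simp]:
  assumes "i \<in> I"
  shows "meet (direct_product I A) f g i = meet (A i) (f i) (g i)"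
    "join (direct_product I A) f g i = join (A i) (f i) (g i)"
    "impl (direct_product I A) f g i = impl (A i) (f i) (g i)"
    "zero (direct_product I A) i = zero (A i)"
    "one (direct_product I A) i = one (A i)"
  using assms by (simp_all add: direct_product_def)

lemma direct_product_eq_iff:
  assumes "f \<in> carr (direct_product I A)" "g \<in> carr (direct_product I A)"
  shows "f = g \<longleftrightarrow> (\<forall>i\<in>I. f i = g i)"
  using assms PiE_ext[of f I "\<lambda>i. carr (A i)" g] by (auto simp: carr_direct_product)

lemma closed_direct_product:
  assumes "\<And>i. i \<in> I \<Longrightarrow> closed_under_operations (A i)"
  shows "closed_under_operations (direct_product I A)"
  unfolding closed_under_operations_def using assms by (auto simp: direct_product_def PiE_iff)

lemma valuations_direct_product:
  "v \<in> valuations (direct_product I A) \<longleftrightarrow>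
    (\<forall>j. v j \<in> extensional I) \<and> (\<forall>i\<in>I. (\<lambda>j. v j i) \<in> valuations (A i))"
  by (auto simp: valuations_iff carr_direct_product PiE_iff)

lemma eval_direct_product:
  "i \<in> I \<Longrightarrow> eval (direct_product I A) v \<phi> i = eval (A i) (\<lambda>j. v j i) \<phi>"
  by (induction \<phi>) auto

lemma eval_direct_product_eq_iff:
  assumes "\<And>i. i \<in> I \<Longrightarrow> closed_under_operations (A i)" "v \<in> valuations (direct_product I A)"
  shows "eval (direct_product I A) v s = eval (direct_product I A) v t \<longleftrightarrow>
    (\<forall>i\<in>I. eval (A i) (\<lambda>j. v j i) s = eval (A i) (\<lambda>j. v j i) t)"
  using assms closed_direct_product[of I A]
  by (simp add: direct_product_eq_iff[of _ I A] eval_direct_product)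

lemma eval_direct_product_eq_one_iff:
  assumes "\<And>i. i \<in> I \<Longrightarrow> closed_under_operations (A i)" "v \<in> valuations (direct_product I A)"
  shows "eval (direct_product I A) v \<phi> = one (direct_product I A) \<longleftrightarrow>
    (\<forall>i\<in>I. eval (A i) (\<lambda>j. v j i) \<phi> = one (A i))"
  using eval_direct_product_eq_iff[OF assms, of \<phi> Top] by simp

lemma heyting_algebra_direct_product:
  fixes A :: "'i \<Rightarrow> 'a heyting"
  assumes A: "\<And>i. i \<in> I \<Longrightarrow> heyting_algebra (A i)"
  shows "heyting_algebra (direct_product I A)"
proof (rule heyting_algebraI)
  show "closed_under_operations (direct_product I A)"
    using A by (intro closed_direct_product) simp
  fix s t s' t' v
  assume "heyting_quasi_identity TYPE('a) (s, t) (s', t')" "v \<in> valuations (direct_product I A)"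
    "eval (direct_product I A) v s = eval (direct_product I A) v t"
  then show "eval (direct_product I A) v s' = eval (direct_product I A) v t'"
    using A heyting_quasi_identityD
    by (simp add: eval_direct_product_eq_iff valuations_direct_product) blast
qed

lemma sat_all_direct_product:
  assumes A: "\<And>i. i \<in> I \<Longrightarrow> closed_under_operations (A i)"
    and v: "v \<in> valuations (direct_product I A)"
  shows "sat_all (direct_product I A) X v \<phi> \<longleftrightarrow> (\<forall>i\<in>I. sat_all (A i) X (\<lambda>j. v j i) \<phi>)"
proof -
  have eval: "eval (direct_product I A) w \<phi> = one (direct_product I A) \<longleftrightarrow>
      (\<forall>i\<in>I. eval (A i) (\<lambda>j. w j i) \<phi> = one (A i))" if "w \<in> valuations (direct_product I A)" for w
    using A that by (rule eval_direct_product_eq_one_iff)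
  show ?thesis
  proof (intro iffI ballI)
    fix i assume sat: "sat_all (direct_product I A) X v \<phi>" and i: "i \<in> I"
    show "sat_all (A i) X (\<lambda>j. v j i) \<phi>"
      unfolding sat_all_def
    proof
      fix w assume w: "w \<in> variants (A i) X (\<lambda>j. v j i)"
      define u where "u j = (v j)(i := w j)" for j
      have "u \<in> variants (direct_product I A) X v"
        using v w i by (auto simp: variants_iff valuations_iff carr_direct_product u_def PiE_iff
            extensional_def)
      then have "eval (A i) (\<lambda>j. u j i) \<phi> = one (A i)"
        using sat eval[of u] i by (simp add: sat_all_def variants_iff)
      then show "eval (A i) w \<phi> = one (A i)"
        by (simp add: u_def)
    qed
  next
    assume sat: "\<forall>i\<in>I. sat_all (A i) X (\<lambda>j. v j i) \<phi>"
    show "sat_all (direct_product I A) X v \<phi>"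
      unfolding sat_all_def
    proof
      fix w assume w: "w \<in> variants (direct_product I A) X v"
      then have "(\<lambda>j. w j i) \<in> variants (A i) X (\<lambda>j. v j i)" if "i \<in> I" for i
        using that by (simp add: variants_iff valuations_direct_product)
      then show "eval (direct_product I A) w \<phi> = one (direct_product I A)"
        using sat eval[of w] w by (simp add: sat_all_def variants_iff)
    qed
  qed
qed

lemma valid_direct_product:
  assumes A: "\<And>i. i \<in> I \<Longrightarrow> closed_under_operations (A i)"
    and R: "\<And>i. i \<in> I \<Longrightarrow> valid (A i) R"
  shows "valid (direct_product I A) R"
proof -
  obtain \<Gamma> Q \<psi> where R_eq: "R = (\<Gamma>, Q, \<psi>)" by (cases R)
  show ?thesis
    unfolding R_eq valid_iff
  proof (intro ballI impI)
    fix v assume v: "v \<in> valuations (direct_product I A)"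
      and \<Gamma>: "\<forall>\<gamma>\<in>\<Gamma>. sat_all (direct_product I A) Q v \<gamma>"
    have "eval (A i) (\<lambda>j. v j i) \<psi> = one (A i)" if i: "i \<in> I" for i
      using R[OF i] \<Gamma> v i A
      by (simp add: R_eq valid_iff sat_all_direct_product valuations_direct_product)
    then show "eval (direct_product I A) v \<psi> = one (direct_product I A)"
      by (simp add: eval_direct_product_eq_one_iff[OF A v])
  qed
qed

lemma refutes_direct_product:
  assumes A: "\<And>i. i \<in> I \<Longrightarrow> closed_under_operations (A i)"
    and ref: "\<And>i. i \<in> I \<Longrightarrow> refutes (A i) (v i) \<Gamma> Q {\<psi> i}"
  shows "refutes (direct_product I A) (\<lambda>j. \<lambda>i\<in>I. v i j) \<Gamma> Q (\<psi> ` I)"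
proof -
  let ?v = "\<lambda>j. \<lambda>i\<in>I. v i j"
  have component: "(\<lambda>j. ?v j i) = v i" if "i \<in> I" for i
    using that by simp
  have v: "?v \<in> valuations (direct_product I A)"
    using ref by (simp add: valuations_direct_product component refutes_def)
  moreover have "eval (direct_product I A) ?v (\<psi> i) \<noteq> one (direct_product I A)" if "i \<in> I" for i
    using eval_direct_product_eq_one_iff[OF A v, of "\<psi> i"] ref[OF that] that
    by (auto simp: component refutes_def)
  ultimately show ?thesis
    using A ref by (auto simp: refutes_def sat_all_direct_product component)
qed

section \<open>Ultrafilters and ultraproducts\<close>

definition finite_intersection_property :: "'i set \<Rightarrow> 'i set set \<Rightarrow> bool" where
  "finite_intersection_property I C \<longleftrightarrow> C \<subseteq> Pow I \<and>
     (\<forall>G. finite G \<longrightarrow> G \<subseteq> C \<longrightarrow> I \<inter> \<Inter>G \<noteq> {})"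

lemma finite_intersection_property_chain_Union:
  assumes ne: "\<C> \<noteq> {}" and chain: "subset.chain {C. finite_intersection_property I C} \<C>"
  shows "finite_intersection_property I (\<Union>\<C>)"
proof -
  have fip: "finite_intersection_property I C" if "C \<in> \<C>" for C
    using chain that by (auto simp: subset.chain_def)
  have "I \<inter> \<Inter>G \<noteq> {}" if G: "finite G" "G \<subseteq> \<Union>\<C>" for G
  proof -
    obtain C where "C \<in> \<C>" "G \<subseteq> C"
      using finite_subset_Union_chain[OF G ne chain] by blast
    then show ?thesis
      using fip G(1) unfolding finite_intersection_property_def by blast
  qed
  moreover have "\<Union>\<C> \<subseteq> Pow I"
    using fip unfolding finite_intersection_property_def by blast
  ultimately show ?thesis
    by (simp add: finite_intersection_property_def)
qed

lemma maximal_finite_intersection_property_ultrafilter: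
  assumes fip: "finite_intersection_property I U"
    and max: "\<And>V. finite_intersection_property I V \<Longrightarrow> U \<subseteq> V \<Longrightarrow> V = U"
  shows "ultrafilter_on I U"
proof -
  have UI: "U \<subseteq> Pow I" and inter: "\<And>G. finite G \<Longrightarrow> G \<subseteq> U \<Longrightarrow> I \<inter> \<Inter>G \<noteq> {}"
    using fip by (simp_all add: finite_intersection_property_def)
  have memI: "Y \<in> U" if Y: "Y \<subseteq> I" and meets: "\<And>G. finite G \<Longrightarrow> G \<subseteq> U \<Longrightarrow> Y \<inter> \<Inter>G \<noteq> {}" for Y
  proof -
    have "I \<inter> \<Inter>H \<noteq> {}" if H: "finite H" "H \<subseteq> insert Y U" for H
      using meets[of "H - {Y}"] Y H by (cases "Y \<in> H") blast+
    then have "finite_intersection_property I (insert Y U)"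
      using UI Y by (simp add: finite_intersection_property_def)
    then show ?thesis
      using max by blast
  qed
  have upward: "Y \<in> U" if G: "finite G" "G \<subseteq> U" and Y: "I \<inter> \<Inter>G \<subseteq> Y" "Y \<subseteq> I" for G Y
  proof (rule memI[OF Y(2)])
    fix H assume "finite H" "H \<subseteq> U"
    then have "I \<inter> \<Inter>(G \<union> H) \<noteq> {}"
      using G by (intro inter) auto
    then show "Y \<inter> \<Inter>H \<noteq> {}"
      using Y(1) by blast
  qed
  have "X \<in> U \<or> I - X \<in> U" if X: "X \<subseteq> I" for X
  proof (rule disjCI, rule memI[OF X], rule notI)
    fix G assume "I - X \<notin> U" "finite G" "G \<subseteq> U" "X \<inter> \<Inter>G = {}"
    then show False
      using upward[of G "I - X"] by blast
  qed
  moreover have "I \<in> U" "{} \<notin> U"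
    using upward[of "{}" I] inter[of "{{}}"] by auto
  moreover have "X \<inter> Y \<in> U" if "X \<in> U" "Y \<in> U" for X Y
    using upward[of "{X, Y}" "X \<inter> Y"] that UI by auto
  moreover have "Y \<in> U" if "X \<in> U" "X \<subseteq> Y" "Y \<subseteq> I" for X Y
    using upward[of "{X}" Y] that by auto
  ultimately show ?thesis
    using UI by (auto simp: ultrafilter_on_def)
qed

lemma ultrafilter_extending:
  assumes "finite_intersection_property I C"
  obtains U where "ultrafilter_on I U" "C \<subseteq> U"
proof -
  let ?F = "{D. finite_intersection_property I D \<and> C \<subseteq> D}"
  have "\<exists>U\<in>?F. \<forall>V\<in>?F. U \<subseteq> V \<longrightarrow> V = U"
  proof (rule subset_Zorn_nonempty)
    show "?F \<noteq> {}"
      using assms by blast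
    fix \<C> assume ne: "\<C> \<noteq> {}" and chain: "subset.chain ?F \<C>"
    then have "subset.chain {D. finite_intersection_property I D} \<C>" "\<forall>D\<in>\<C>. C \<subseteq> D"
      by (auto simp: subset.chain_def)
    then show "\<Union>\<C> \<in> ?F"
      using finite_intersection_property_chain_Union[OF ne] ne by blast
  qed
  then obtain U where U: "finite_intersection_property I U" "C \<subseteq> U"
    and max: "\<forall>V\<in>?F. U \<subseteq> V \<longrightarrow> V = U" by blast
  have "ultrafilter_on I U"
    by (rule maximal_finite_intersection_property_ultrafilter[OF U(1)]) (use U(2) max in blast)
  then show thesis
    using that U(2) by blast
qed

lemma ultrafilter_on_complement: "ultrafilter_on I U \<Longrightarrow> X \<subseteq> I \<Longrightarrow> X \<in> U \<or> I - X \<in> U"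
  by (simp add: ultrafilter_on_def)

locale heyting_ultraproduct =
  fixes I :: "'i set" and U :: "'i set set" and A :: "'i \<Rightarrow> 'a heyting"
  assumes ultrafilter: "ultrafilter_on I U"
    and closed: "\<And>i. i \<in> I \<Longrightarrow> closed_under_operations (A i)"
begin

abbreviation "product_alg \<equiv> direct_product I A"
abbreviation "quotient_alg \<equiv> ultraproduct I U A"
abbreviation "class_of f \<equiv> ultra_rel I U A `` {f}"

definition index_filter :: "'i filter" where
  "index_filter = Abs_filter (\<lambda>p. {i \<in> I. p i} \<in> U)"

lemma eventually_index_filter: "eventually p index_filter \<longleftrightarrow> {i \<in> I. p i} \<in> U"
proof -
  have "is_filter (\<lambda>p. {i \<in> I. p i} \<in> U)"
  proof
    show "{i \<in> I. True} \<in> U"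
      using ultrafilter by (simp add: ultrafilter_on_def)
    fix p q :: "'i \<Rightarrow> bool"
    show "{i \<in> I. p i \<and> q i} \<in> U" if "{i \<in> I. p i} \<in> U" "{i \<in> I. q i} \<in> U"
    proof -
      have "{i \<in> I. p i} \<inter> {i \<in> I. q i} \<in> U"
        using ultrafilter that by (simp add: ultrafilter_on_def)
      then show ?thesis
        by (simp add: Collect_conj_eq Int_ac)
    qed
    show "{i \<in> I. q i} \<in> U" if "\<forall>i. p i \<longrightarrow> q i" "{i \<in> I. p i} \<in> U"
    proof -
      have "{i \<in> I. p i} \<subseteq> {i \<in> I. q i} \<and> {i \<in> I. q i} \<subseteq> I"
        using that(1) by blast
      then show ?thesis
        using ultrafilter that(2) unfolding ultrafilter_on_def by blast
    qed
  qed
  then show ?thesis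
    by (simp add: index_filter_def eventually_Abs_filter)
qed

lemma eventually_index: "\<forall>\<^sub>F i in index_filter. i \<in> I"
  using ultrafilter by (simp add: eventually_index_filter ultrafilter_on_def)

lemma index_filter_neq_bot: "index_filter \<noteq> bot"
proof -
  have "{} \<notin> U"
    using ultrafilter unfolding ultrafilter_on_def by blast
  then have "\<not> (\<forall>\<^sub>F i in index_filter. False)"
    by (simp only: eventually_index_filter) simp
  then show ?thesis by auto
qed

lemma eventually_not_iff:
  "(\<forall>\<^sub>F i in index_filter. \<not> p i) \<longleftrightarrow> \<not> (\<forall>\<^sub>F i in index_filter. p i)"
proof
  assume "\<forall>\<^sub>F i in index_filter. \<not> p i"
  then show "\<not> (\<forall>\<^sub>F i in index_filter. p i)"
    using eventually_happens'[OF index_filter_neq_bot eventually_conj] by blast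
next
  assume "\<not> (\<forall>\<^sub>F i in index_filter. p i)"
  then have "{i \<in> I. p i} \<notin> U"
    by (simp add: eventually_index_filter)
  then have "I - {i \<in> I. p i} \<in> U"
    using ultrafilter_on_complement[OF ultrafilter, of "{i \<in> I. p i}"] by blast
  also have "I - {i \<in> I. p i} = {i \<in> I. \<not> p i}" by blast
  finally show "\<forall>\<^sub>F i in index_filter. \<not> p i"
    by (simp add: eventually_index_filter)
qed

lemma eventually_cong_index:
  "(\<And>i. i \<in> I \<Longrightarrow> p i \<longleftrightarrow> q i) \<Longrightarrow>
    (\<forall>\<^sub>F i in index_filter. p i) \<longleftrightarrow> (\<forall>\<^sub>F i in index_filter. q i)"
  by (simp add: eventually_index_filter cong: conj_cong)

lemma closed_product_alg: "closed_under_operations product_alg"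
  by (rule closed_direct_product) (rule closed)

lemma ultra_rel_iff:
  "(f, g) \<in> ultra_rel I U A \<longleftrightarrow>
    f \<in> carr product_alg \<and> g \<in> carr product_alg \<and> (\<forall>\<^sub>F i in index_filter. f i = g i)"
  by (simp add: ultra_rel_def eventually_index_filter)

lemma equiv_ultra_rel: "equiv (carr product_alg) (ultra_rel I U A)"
proof (rule equivI)
  show "ultra_rel I U A \<subseteq> carr product_alg \<times> carr product_alg"
    by (auto simp: ultra_rel_def)
  show "refl_on (carr product_alg) (ultra_rel I U A)"
    by (auto simp: refl_on_def ultra_rel_iff)
  show "sym (ultra_rel I U A)"
    by (auto simp: sym_def ultra_rel_iff eq_commute)
  show "trans (ultra_rel I U A)"
    by (auto simp: trans_def ultra_rel_iff elim: eventually_elim2)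
qed

lemma class_of_eq_iff:
  "f \<in> carr product_alg \<Longrightarrow> g \<in> carr product_alg \<Longrightarrow>
    class_of f = class_of g \<longleftrightarrow> (\<forall>\<^sub>F i in index_filter. f i = g i)"
  using eq_equiv_class_iff[OF equiv_ultra_rel, of f g] by (simp add: ultra_rel_iff)

lemma carr_quotient_alg: "carr quotient_alg = class_of ` carr product_alg"
  by (auto simp: ultraproduct_def Let_def quotient_def)

lemma class_of_operation:
  assumes f: "f \<in> carr product_alg" and g: "g \<in> carr product_alg"
    and closed: "\<And>f g. f \<in> carr product_alg \<Longrightarrow> g \<in> carr product_alg \<Longrightarrow> op f g \<in> carr product_alg"
    and component: "\<And>f g i. i \<in> I \<Longrightarrow> op f g i = opA i (f i) (g i)"
  shows "ultra_rel I U A `` {op f' g' | f' g'. f' \<in> class_of f \<and> g' \<in> class_of g} =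
    class_of (op f g)"
proof -
  have "class_of (op f' g') = class_of (op f g)" if "f' \<in> class_of f" "g' \<in> class_of g" for f' g'
  proof -
    have f': "f' \<in> carr product_alg" "\<forall>\<^sub>F i in index_filter. f i = f' i"
      and g': "g' \<in> carr product_alg" "\<forall>\<^sub>F i in index_filter. g i = g' i"
      using that by (simp_all add: ultra_rel_iff)
    have "\<forall>\<^sub>F i in index_filter. op f' g' i = op f g i"
      using f'(2) g'(2) eventually_index by eventually_elim (simp add: component)
    then show ?thesis
      using f f'(1) g g'(1) closed by (simp add: class_of_eq_iff)
  qed
  moreover have "f \<in> class_of f" "g \<in> class_of g"
    using equiv_class_self[OF equiv_ultra_rel] f g by auto
  ultimately show ?thesis by blast
qed

lemma quotient_alg_operations:
  assumes "f \<in> carr product_alg" "g \<in> carr product_alg"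
  shows "meet quotient_alg (class_of f) (class_of g) = class_of (meet product_alg f g)"
    "join quotient_alg (class_of f) (class_of g) = class_of (join product_alg f g)"
    "impl quotient_alg (class_of f) (class_of g) = class_of (impl product_alg f g)"
  using class_of_operation[OF assms, of "meet product_alg" "\<lambda>i. meet (A i)"]
    class_of_operation[OF assms, of "join product_alg" "\<lambda>i. join (A i)"]
    class_of_operation[OF assms, of "impl product_alg" "\<lambda>i. impl (A i)"] closed_product_alg
  by (simp_all add: ultraproduct_def Let_def)

lemma quotient_alg_constants:
  "zero quotient_alg = class_of (zero product_alg)" "one quotient_alg = class_of (one product_alg)"
  by (simp_all add: ultraproduct_def Let_def)

lemma class_of_hom: "heyting_hom class_of product_alg quotient_alg"
  using closed_product_alg
  by (auto simp: heyting_hom_def carr_quotient_alg quotient_alg_operations quotient_alg_constants)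

lemma closed_quotient_alg: "closed_under_operations quotient_alg"
  using closed_product_alg
  by (auto simp: closed_under_operations_def[of quotient_alg] carr_quotient_alg
      quotient_alg_operations quotient_alg_constants)

lemma valuations_quotient_alg:
  assumes "v \<in> valuations quotient_alg"
  obtains f where "f \<in> valuations product_alg" "v = class_of \<circ> f"
  using valuations_surj[of class_of product_alg quotient_alg v] assms carr_quotient_alg by metis

lemma eval_quotient_alg_eq_iff:
  assumes f: "f \<in> valuations product_alg"
  shows "eval quotient_alg (class_of \<circ> f) s = eval quotient_alg (class_of \<circ> f) t \<longleftrightarrow>
    (\<forall>\<^sub>F i in index_filter. eval (A i) (\<lambda>j. f j i) s = eval (A i) (\<lambda>j. f j i) t)"
proof -
  have "eval quotient_alg (class_of \<circ> f) s = eval quotient_alg (class_of \<circ> f) t \<longleftrightarrow>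
      (\<forall>\<^sub>F i in index_filter. eval product_alg f s i = eval product_alg f t i)"
    using f closed_product_alg
    by (simp add: eval_hom[OF closed_product_alg class_of_hom f] class_of_eq_iff)
  also have "\<dots> \<longleftrightarrow>
      (\<forall>\<^sub>F i in index_filter. eval (A i) (\<lambda>j. f j i) s = eval (A i) (\<lambda>j. f j i) t)"
    by (rule eventually_cong_index) (simp add: eval_direct_product)
  finally show ?thesis .
qed

lemma eval_quotient_alg_eq_one_iff:
  "f \<in> valuations product_alg \<Longrightarrow> eval quotient_alg (class_of \<circ> f) \<phi> = one quotient_alg \<longleftrightarrow>
    (\<forall>\<^sub>F i in index_filter. eval (A i) (\<lambda>j. f j i) \<phi> = one (A i))"
  using eval_quotient_alg_eq_iff[of f \<phi> Top] by simp

lemma heyting_algebra_ultraproduct: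
  assumes A: "\<And>i. i \<in> I \<Longrightarrow> heyting_algebra (A i)"
  shows "heyting_algebra quotient_alg"
proof (rule heyting_algebraI[OF closed_quotient_alg])
  fix s t s' t' v
  assume qi: "heyting_quasi_identity TYPE('a) (s, t) (s', t')" and "v \<in> valuations quotient_alg"
    and eq: "eval quotient_alg v s = eval quotient_alg v t"
  then obtain f where f: "f \<in> valuations product_alg" and v: "v = class_of \<circ> f"
    using valuations_quotient_alg by blast
  have "\<forall>\<^sub>F i in index_filter. eval (A i) (\<lambda>j. f j i) s = eval (A i) (\<lambda>j. f j i) t"
    using eq eval_quotient_alg_eq_iff[OF f] by (simp add: v)
  then have "\<forall>\<^sub>F i in index_filter. eval (A i) (\<lambda>j. f j i) s' = eval (A i) (\<lambda>j. f j i) t'"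
    using eventually_index
    by eventually_elim
      (use heyting_quasi_identityD[OF qi A] f in \<open>auto simp: valuations_direct_product\<close>)
  then show "eval quotient_alg v s' = eval quotient_alg v t'"
    using eval_quotient_alg_eq_iff[OF f] by (simp add: v)
qed

lemma sat_all_ultraproductD:
  assumes f: "f \<in> valuations product_alg"
    and sat: "sat_all quotient_alg X (class_of \<circ> f) \<phi>"
  shows "\<forall>\<^sub>F i in index_filter. sat_all (A i) X (\<lambda>j. f j i) \<phi>"
proof -
  define generic where "generic i w \<longleftrightarrow> w \<in> variants (A i) X (\<lambda>j. f j i) \<and>
    (eval (A i) w \<phi> = one (A i) \<longrightarrow> sat_all (A i) X (\<lambda>j. f j i) \<phi>)" for i w
  have "\<exists>w. generic i w" if "i \<in> I" for i
  proof (cases "sat_all (A i) X (\<lambda>j. f j i) \<phi>")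
    case True
    then have "generic i (\<lambda>j. f j i)"
      using f that by (simp add: generic_def variants_iff valuations_direct_product)
    then show ?thesis by blast
  next
    case False
    then show ?thesis
      by (auto simp: generic_def sat_all_def)
  qed
  then obtain w where w: "\<And>i. i \<in> I \<Longrightarrow> generic i (w i)" by metis
  define g where "g j = (\<lambda>i\<in>I. w i j)" for j
  have g: "g \<in> valuations product_alg"
    using w by (auto simp: g_def generic_def variants_iff valuations_direct_product)
  have "g j = f j" if "j \<notin> X" for j
    using w that direct_product_eq_iff[OF valuations_carr[OF g] valuations_carr[OF f], of j j]
    by (simp add: g_def generic_def variants_iff)
  then have "g \<in> variants product_alg X f"
    using g by (simp add: variants_iff)
  then have "class_of \<circ> g \<in> variants quotient_alg X (class_of \<circ> f)"
    by (rule heyting_hom_variants[OF class_of_hom])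
  then have "eval quotient_alg (class_of \<circ> g) \<phi> = one quotient_alg"
    using sat by (simp add: sat_all_def)
  then have "\<forall>\<^sub>F i in index_filter. eval (A i) (\<lambda>j. g j i) \<phi> = one (A i)"
    by (simp add: eval_quotient_alg_eq_one_iff[OF g])
  then show ?thesis
    using eventually_index by eventually_elim (use w in \<open>auto simp: g_def generic_def\<close>)
qed

lemma sat_all_ultraproductI:
  assumes f: "f \<in> valuations product_alg"
    and sat: "\<forall>\<^sub>F i in index_filter. sat_all (A i) X (\<lambda>j. f j i) \<phi>"
  shows "sat_all quotient_alg X (class_of \<circ> f) \<phi>"
  unfolding sat_all_def
proof
  fix w assume w: "w \<in> variants quotient_alg X (class_of \<circ> f)"
  then obtain g where g: "g \<in> valuations product_alg" "w = class_of \<circ> g"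
    using valuations_quotient_alg by (auto simp: variants_iff)
  define u where "u j = (if j \<in> X then g j else f j)" for j
  have u: "u \<in> valuations product_alg"
    using f g(1) by (simp add: u_def valuations_iff)
  have w_eq: "w = class_of \<circ> u"
    using w g(2) by (auto simp: u_def variants_iff fun_eq_iff)
  have "\<forall>\<^sub>F i in index_filter. eval (A i) (\<lambda>j. u j i) \<phi> = one (A i)"
    using sat eventually_index
  proof eventually_elim
    case (elim i)
    then have "(\<lambda>j. u j i) \<in> variants (A i) X (\<lambda>j. f j i)"
      using u by (simp add: variants_iff valuations_direct_product) (simp add: u_def)
    then show ?case
      using elim(1) by (simp add: sat_all_def)
  qed
  then show "eval quotient_alg w \<phi> = one quotient_alg"
    by (simp add: w_eq eval_quotient_alg_eq_one_iff[OF u])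
qed

lemma sat_all_ultraproduct_iff:
  "f \<in> valuations product_alg \<Longrightarrow> sat_all quotient_alg X (class_of \<circ> f) \<phi> \<longleftrightarrow>
    (\<forall>\<^sub>F i in index_filter. sat_all (A i) X (\<lambda>j. f j i) \<phi>)"
  using sat_all_ultraproductD sat_all_ultraproductI by blast

lemma valid_ultraproduct:
  assumes R: "\<And>i. i \<in> I \<Longrightarrow> valid (A i) R" and "R \<in> pi2_rules"
  shows "valid quotient_alg R"
proof -
  obtain \<Gamma> Q \<psi> where R_eq: "R = (\<Gamma>, Q, \<psi>)" by (cases R)
  have fin: "finite \<Gamma>"
    using assms(2) by (simp add: R_eq pi2_rules_def)
  show ?thesis
    unfolding R_eq valid_iff
  proof (intro ballI impI)
    fix v assume "v \<in> valuations quotient_alg" and \<Gamma>: "\<forall>\<gamma>\<in>\<Gamma>. sat_all quotient_alg Q v \<gamma>"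
    then obtain f where f: "f \<in> valuations product_alg" and v: "v = class_of \<circ> f"
      using valuations_quotient_alg by blast
    have "\<forall>\<^sub>F i in index_filter. \<forall>\<gamma>\<in>\<Gamma>. sat_all (A i) Q (\<lambda>j. f j i) \<gamma>"
      using \<Gamma> fin by (simp add: v sat_all_ultraproduct_iff[OF f] eventually_ball_finite)
    then have "\<forall>\<^sub>F i in index_filter. eval (A i) (\<lambda>j. f j i) \<psi> = one (A i)"
      using eventually_index
      by eventually_elim (use R f in \<open>auto simp: R_eq valid_iff valuations_direct_product\<close>)
    then show "eval quotient_alg v \<psi> = one quotient_alg"
      by (simp add: v eval_quotient_alg_eq_one_iff[OF f])
  qed
qed

lemma forall_embedding_ultraproduct:
  assumes h: "\<And>i a. i \<in> I \<Longrightarrow> h i a \<in> carr (A i)"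
    and preserves: "\<And>v X \<phi>. v \<in> valuations B \<Longrightarrow> sat_all B X v \<phi> \<Longrightarrow>
      \<forall>\<^sub>F i in index_filter. sat_all (A i) X (h i \<circ> v) \<phi>"
    and reflects: "\<And>v \<phi>. v \<in> valuations B \<Longrightarrow> eval B v \<phi> \<noteq> one B \<Longrightarrow>
      \<forall>\<^sub>F i in index_filter. eval (A i) (h i \<circ> v) \<phi> \<noteq> one (A i)"
  shows "forall_embedding (\<lambda>a. class_of (\<lambda>i\<in>I. h i a)) B quotient_alg"
proof -
  define f where "f a = (\<lambda>i\<in>I. h i a)" for a
  have f: "f a \<in> carr product_alg" for a
    using h by (auto simp: f_def carr_direct_product)
  then have fv: "f \<circ> v \<in> valuations product_alg" for v
    by (simp add: valuations_iff)
  have "(\<lambda>j. (f \<circ> v) j i) = h i \<circ> v" if "i \<in> I" for i and v :: "nat \<Rightarrow> _"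
    using that by (auto simp: f_def)
  then have component: "(\<forall>\<^sub>F i in index_filter. p i (\<lambda>j. (f \<circ> v) j i)) \<longleftrightarrow>
      (\<forall>\<^sub>F i in index_filter. p i (h i \<circ> v))" for p and v :: "nat \<Rightarrow> _"
    by (intro eventually_cong_index) (simp only:)
  have "forall_embedding (class_of \<circ> f) B quotient_alg"
  proof (rule forall_embeddingI)
    show "(class_of \<circ> f) ` carr B \<subseteq> carr quotient_alg"
      using f by (auto simp: carr_quotient_alg)
  next
    fix v X \<phi> assume "v \<in> valuations B" "sat_all B X v \<phi>"
    then show "sat_all quotient_alg X (class_of \<circ> f \<circ> v) \<phi>"
      using preserves component[of "\<lambda>i u. sat_all (A i) X u \<phi>" v]
      by (simp only: sat_all_ultraproduct_iff[OF fv] comp_assoc)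
  next
    fix v \<phi> assume v: "v \<in> valuations B"
      and "eval quotient_alg (class_of \<circ> f \<circ> v) \<phi> = one quotient_alg"
    then have "\<forall>\<^sub>F i in index_filter. eval (A i) (h i \<circ> v) \<phi> = one (A i)"
      using component[of "\<lambda>i u. eval (A i) u \<phi> = one (A i)" v]
      by (simp only: eval_quotient_alg_eq_one_iff[OF fv] comp_assoc)
    then show "eval B v \<phi> = one B"
      using reflects[OF v, of \<phi>] by (auto simp: eventually_not_iff)
  qed
  then show ?thesis
    by (simp add: f_def comp_def)
qed

end

section \<open>Closure properties of inductive rule classes\<close>

lemma inductive_rule_class_members:
  assumes "inductive_rule_class TYPE('i) K" "A \<in> K"
  shows "heyting_algebra A" "godel_algebra A" "nondegenerate A"
proof -
  have "\<forall>A\<in>K. godel_algebra A \<and> nondegenerate A"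
    using assms(1) unfolding inductive_rule_class_def by (elim conjE)
  then show "heyting_algebra A" "godel_algebra A" "nondegenerate A"
    using assms(2) by (simp_all add: godel_algebra_def)
qed

lemma inductive_rule_class_copy:
  assumes "inductive_rule_class TYPE('i) K" "A \<in> K" "copy_of_forall_subalgebra B A"
  shows "B \<in> K"
proof -
  have "\<forall>A\<in>K. \<forall>B. copy_of_forall_subalgebra B A \<longrightarrow> B \<in> K"
    using assms(1) unfolding inductive_rule_class_def by (elim conjE)
  then show ?thesis
    using assms(2,3) by blast
qed

lemma inductive_rule_class_product:
  fixes I :: "'i set"
  assumes "inductive_rule_class TYPE('i) K" "I \<noteq> {}" "\<And>i. i \<in> I \<Longrightarrow> A i \<in> K"
    "copy_of_forall_subalgebra B (direct_product I A)"
  shows "B \<in> K"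
proof -
  have "\<forall>(I :: 'i set) A B. I \<noteq> {} \<longrightarrow> (\<forall>i\<in>I. A i \<in> K) \<longrightarrow>
      copy_of_forall_subalgebra B (direct_product I A) \<longrightarrow> B \<in> K"
    using assms(1) unfolding inductive_rule_class_def by (elim conjE)
  then show ?thesis
    using assms(2-4) by blast
qed

lemma inductive_rule_class_ultraproduct:
  fixes I :: "'i set"
  assumes "inductive_rule_class TYPE('i) K" "ultrafilter_on I U" "\<And>i. i \<in> I \<Longrightarrow> A i \<in> K"
    "copy_of_forall_subalgebra B (ultraproduct I U A)"
  shows "B \<in> K"
proof -
  have "\<forall>(I :: 'i set) U A B. ultrafilter_on I U \<longrightarrow> (\<forall>i\<in>I. A i \<in> K) \<longrightarrow>
      copy_of_forall_subalgebra B (ultraproduct I U A) \<longrightarrow> B \<in> K"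
    using assms(1) unfolding inductive_rule_class_def by (elim conjE)
  then show ?thesis
    using assms(2-4) by blast
qed

instance fm :: countable
  by countable_datatype

lemma infinite_inj_list_countable:
  assumes "infinite (UNIV :: 'a set)"
  obtains g :: "'a list \<times> 'b::countable \<Rightarrow> 'a" where "inj g"
proof -
  obtain p where p: "bij_betw p ((UNIV :: 'a set) \<times> (UNIV :: 'a set)) (UNIV :: 'a set)"
    using card_of_Times_same_infinite[OF assms] unfolding card_of_ordIso[symmetric] by blast
  then have p: "inj p"
    by (simp add: bij_betw_def)
  obtain c :: "nat \<Rightarrow> 'a" where c: "inj c"
    using infinite_countable_subset[OF assms] by blast
  define code where "code xs = foldr (\<lambda>x r. p (x, r)) xs (c 0)" for xs
  have "xs = ys" if "length xs = length ys" "code xs = code ys" for xs ys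
    using that
    by (induction xs ys rule: list_induct2) (use p in \<open>auto simp: code_def dest: injD\<close>)
  then have "inj (\<lambda>(xs, b :: 'b). p (c (to_nat (length xs, b)), code xs))"
    by (auto intro!: injI simp: inj_eq[OF p] inj_eq[OF c])
  then show thesis
    by (rule that)
qed

locale large_inductive_rule_class =
  fixes K :: "'a heyting set" and e :: "'a \<Rightarrow> 'i"
  assumes infinite_UNIV: "infinite (UNIV :: 'a set)"
    and inj_e: "inj e"
    and inductive_class: "inductive_rule_class TYPE('i) K"
begin

lemmas members = inductive_rule_class_members[OF inductive_class]

lemma finite_product_in_class:
  fixes I :: "'i set"
  assumes I: "finite I" "I \<noteq> {}" and A: "\<And>i. i \<in> I \<Longrightarrow> A i \<in> K"
  obtains D where "D \<in> K" "isomorphic D (direct_product I A)"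
proof -
  let ?P = "direct_product I A"
  have P: "heyting_algebra ?P"
    using members(1)[OF A] by (rule heyting_algebra_direct_product)
  obtain g :: "'a list \<times> unit \<Rightarrow> 'a" where g: "inj g"
    using infinite_inj_list_countable[OF infinite_UNIV] by blast
  obtain xs where xs: "set xs = I"
    using finite_list[OF I(1)] by blast
  have "inj_on (\<lambda>f. g (map f xs, ())) (carr ?P)"
    by (rule inj_onI) (simp add: inj_eq[OF g] xs direct_product_eq_iff[of _ I A])
  then obtain D :: "'a heyting" where D: "heyting_algebra D" "isomorphic D ?P"
    using isomorphic_copy[OF P] by blast
  have "forall_subalgebra ?P ?P"
    using P by (simp add: forall_subalgebra_def subalgebra_def)
  then have "copy_of_forall_subalgebra D ?P"
    using D by (auto simp: copy_of_forall_subalgebra_def)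
  with inductive_class I(2) A have "D \<in> K"
    by (rule inductive_rule_class_product)
  then show thesis
    using D(2) by (rule that)
qed

lemma joint_refutation:
  assumes \<Psi>: "finite \<Psi>" "\<Psi> \<noteq> {}"
    and refuted: "\<And>\<psi>. \<psi> \<in> \<Psi> \<Longrightarrow> \<exists>B\<in>K. \<exists>v. refutes B v \<Gamma> Q {\<psi>}"
  obtains B v where "B \<in> K" "refutes B v \<Gamma> Q \<Psi>"
proof -
  obtain g :: "'a list \<times> fm \<Rightarrow> 'a" where g: "inj g"
    using infinite_inj_list_countable[OF infinite_UNIV] by blast
  define \<iota> where "\<iota> \<psi> = e (g ([], \<psi>))" for \<psi>
  have inv_\<iota>: "inv \<iota> (\<iota> \<psi>) = \<psi>" for \<psi>
    by (rule inv_f_f) (auto simp: \<iota>_def inj_def inj_eq[OF inj_e] inj_eq[OF g])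
  obtain B v where B: "\<And>\<psi>. \<psi> \<in> \<Psi> \<Longrightarrow> B \<psi> \<in> K"
    and v: "\<And>\<psi>. \<psi> \<in> \<Psi> \<Longrightarrow> refutes (B \<psi>) (v \<psi>) \<Gamma> Q {\<psi>}"
    using refuted by metis
  let ?A = "\<lambda>i. B (inv \<iota> i)"
  have A: "?A i \<in> K" if "i \<in> \<iota> ` \<Psi>" for i
    using that B by (auto simp: inv_\<iota>)
  then obtain D where D: "D \<in> K" "isomorphic D (direct_product (\<iota> ` \<Psi>) ?A)"
    using finite_product_in_class[of "\<iota> ` \<Psi>" ?A] \<Psi> by blast
  have "refutes (direct_product (\<iota> ` \<Psi>) ?A) (\<lambda>j. \<lambda>i\<in>\<iota> ` \<Psi>. v (inv \<iota> i) j) \<Gamma> Q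
      (inv \<iota> ` \<iota> ` \<Psi>)"
    using members(1)[OF A] v by (intro refutes_direct_product) (auto simp: inv_\<iota>)
  moreover have "inv \<iota> ` \<iota> ` \<Psi> = \<Psi>"
    by (simp add: image_image inv_\<iota>)
  moreover have "closed_under_operations D"
    using members(1)[OF D(1)] by simp
  ultimately obtain u where "refutes D u \<Gamma> Q \<Psi>"
    using refutes_isomorphic[OF D(2)] by metis
  with D(1) show thesis
    by (rule that)
qed

end

section \<open>Inductive rule classes are axiomatized by their rules\<close>

text \<open>Even variables name the parameters listed in \<^term>\<open>bs\<close>, odd variables are bound. Parameters
  outside \<^term>\<open>bs\<close> receive junk names, which \<open>expressible\<close> excludes.\<close>

definition parameter_variable :: "'a list \<Rightarrow> nat set \<Rightarrow> (nat \<Rightarrow> 'a) \<Rightarrow> nat \<Rightarrow> nat" where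
  "parameter_variable bs X v j =
     (if j \<in> X then 2 * j + 1 else 2 * inv_into {..<length bs} ((!) bs) (v j))"

definition name_parameters :: "'a list \<Rightarrow> nat set \<Rightarrow> (nat \<Rightarrow> 'a) \<Rightarrow> fm \<Rightarrow> fm" where
  "name_parameters bs X v = subst (\<lambda>j. Var (parameter_variable bs X v j))"

definition expressible :: "'a list \<Rightarrow> fm list \<Rightarrow> nat set \<Rightarrow> (nat \<Rightarrow> 'a) \<Rightarrow> fm \<Rightarrow> bool" where
  "expressible bs \<Phi> X v \<phi> \<longleftrightarrow>
     v ` (vars \<phi> - X) \<subseteq> set bs \<and> name_parameters bs X v \<phi> \<in> set \<Phi>"

definition parameter_valuation :: "'a heyting \<Rightarrow> 'a list \<Rightarrow> nat \<Rightarrow> 'a" where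
  "parameter_valuation A bs k =
     (if k div 2 < length bs \<and> bs ! (k div 2) \<in> carr A then bs ! (k div 2) else zero A)"

lemma parameter_valuation_valuations:
  "closed_under_operations A \<Longrightarrow> parameter_valuation A bs \<in> valuations A"
  by (simp add: parameter_valuation_def valuations_iff)

lemma parameter_valuation_parameter_variable:
  assumes "v \<in> valuations A" "j \<notin> X" "v j \<in> set bs"
  shows "parameter_valuation A bs (parameter_variable bs X v j) = v j"
proof -
  have "v j \<in> (!) bs ` {..<length bs}"
    using assms(3) by (force simp: in_set_conv_nth)
  then show ?thesis
    using assms(1,2) inv_into_into[of "v j" "(!) bs" "{..<length bs}"]
    by (simp add: parameter_valuation_def parameter_variable_def f_inv_into_f)
qed

lemma sat_all_name_parameters:
  assumes "b \<in> valuations B" "u \<in> valuations B"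
    "\<And>j. j \<in> vars \<phi> - X \<Longrightarrow> b (parameter_variable bs X v j) = u j"
  shows "sat_all B {k. odd k} b (name_parameters bs X v \<phi>) \<longleftrightarrow> sat_all B X u \<phi>"
  unfolding name_parameters_def using assms
  by (intro sat_all_rename) (auto simp: parameter_variable_def inj_on_def)

definition local_embedding ::
    "'a list \<Rightarrow> fm list \<Rightarrow> ('a \<Rightarrow> 'b) \<Rightarrow> 'a heyting \<Rightarrow> 'b heyting \<Rightarrow> bool" where
  "local_embedding bs \<Phi> h A B \<longleftrightarrow> (\<forall>a. h a \<in> carr B) \<and>
     (\<forall>v\<in>valuations A. \<forall>X \<phi>. expressible bs \<Phi> X v \<phi> \<longrightarrow>
        (sat_all A X v \<phi> \<longrightarrow> sat_all B X (h \<circ> v) \<phi>) \<and>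
        (X = {} \<longrightarrow> sat_all B X (h \<circ> v) \<phi> \<longrightarrow> sat_all A X v \<phi>))"

lemma (in heyting_ultraproduct) forall_embedding_of_local_embeddings:
  assumes h: "\<And>i. local_embedding (bs i) (\<Phi> i) (h i) B (A i)"
    and expressible: "\<And>X v \<phi>. \<forall>\<^sub>F i in index_filter. expressible (bs i) (\<Phi> i) X v \<phi>"
  shows "forall_embedding (\<lambda>a. class_of (\<lambda>i\<in>I. h i a)) B quotient_alg"
proof (rule forall_embedding_ultraproduct)
  show "h i a \<in> carr (A i)" for i a
    using h by (simp add: local_embedding_def)
next
  fix v X \<phi> assume "v \<in> valuations B" "sat_all B X v \<phi>"
  with h show "\<forall>\<^sub>F i in index_filter. sat_all (A i) X (h i \<circ> v) \<phi>"
    unfolding local_embedding_def by (intro eventually_mono[OF expressible[of X v \<phi>]]) blast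
next
  fix v \<phi> assume v: "v \<in> valuations B" and "eval B v \<phi> \<noteq> one B"
  then have "\<not> sat_all B {} v \<phi>" by simp
  with h v have "\<forall>\<^sub>F i in index_filter. \<not> sat_all (A i) {} (h i \<circ> v) \<phi>"
    unfolding local_embedding_def by (intro eventually_mono[OF expressible[of "{}" v \<phi>]]) blast
  moreover have "h i \<circ> v \<in> valuations (A i)" for i
    using h by (simp add: local_embedding_def valuations_iff)
  ultimately show "\<forall>\<^sub>F i in index_filter. eval (A i) (h i \<circ> v) \<phi> \<noteq> one (A i)"
    by simp
qed

lemma ultrafilter_of_expressible_sentences:
  fixes g :: "'a list \<times> fm list \<Rightarrow> 'i"
  assumes g: "inj g"
  obtains U where "ultrafilter_on (range g) U"
    "\<And>X v \<phi>. {i \<in> range g. expressible (fst (inv g i)) (snd (inv g i)) X v \<phi>} \<in> U"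
proof -
  define cover where "cover = (\<lambda>(X, v, \<phi>).
    {i \<in> range g. expressible (fst (inv g i)) (snd (inv g i)) X v \<phi>})"
  have "range g \<inter> \<Inter>G \<noteq> {}" if G: "finite G" "G \<subseteq> range cover" for G
  proof -
    obtain F where F: "finite F" "G = cover ` F"
      using finite_subset_image[OF G] by metis
    have "finite (\<Union>(X, v, \<phi>)\<in>F. v ` (vars \<phi> - X))"
      using F(1) by (simp add: case_prod_unfold)
    then obtain bs where bs: "set bs = (\<Union>(X, v, \<phi>)\<in>F. v ` (vars \<phi> - X))"
      using finite_list by metis
    obtain \<Phi> where \<Phi>: "set \<Phi> = (\<lambda>(X, v, \<phi>). name_parameters bs X v \<phi>) ` F"
      using finite_list[OF finite_imageI[OF F(1)]] by metis
    have "expressible bs \<Phi> X v \<phi>" if "(X, v, \<phi>) \<in> F" for X v \<phi>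
      using that by (force simp: expressible_def bs \<Phi>)
    then have "g (bs, \<Phi>) \<in> range g \<inter> \<Inter>G"
      using g by (auto simp: F(2) cover_def)
    then show ?thesis by blast
  qed
  moreover have "range cover \<subseteq> Pow (range g)"
    by (auto simp: cover_def)
  ultimately have "finite_intersection_property (range g) (range cover)"
    by (simp add: finite_intersection_property_def)
  then obtain U where U: "ultrafilter_on (range g) U" "range cover \<subseteq> U"
    by (rule ultrafilter_extending)
  have "cover (X, v, \<phi>) \<in> U" for X v \<phi>
    using U(2) by blast
  then show thesis
    using that[OF U(1)] by (simp add: cover_def)
qed

context large_inductive_rule_class
begin

lemma refuted_in_class:
  assumes A: "\<And>R. R \<in> Pi2 K \<Longrightarrow> valid A R" and R: "(\<Gamma>, Q, \<psi>) \<in> pi2_rules"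
    and refuted: "refutes A a \<Gamma> Q {\<psi>}"
  shows "\<exists>B\<in>K. \<exists>v. refutes B v \<Gamma> Q {\<psi>}"
proof -
  have "\<not> valid A (\<Gamma>, Q, \<psi>)"
    using refuted by (auto simp: valid_iff_not_refutes)
  then have "(\<Gamma>, Q, \<psi>) \<notin> Pi2 K"
    using A by blast
  then show ?thesis
    using R by (auto simp: Pi2_def valid_iff_not_refutes)
qed

lemma finite_diagram_realized:
  assumes A: "nondegenerate A" "\<And>R. R \<in> Pi2 K \<Longrightarrow> valid A R"
    and a: "a \<in> valuations A" and fin: "finite \<Phi>"
  obtains B b where "B \<in> K" "b \<in> valuations B"
    "\<And>\<phi>. \<phi> \<in> \<Phi> \<Longrightarrow> sat_all A Y a \<phi> \<Longrightarrow> sat_all B Y b \<phi>"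
    "\<And>\<phi>. \<phi> \<in> \<Phi> \<Longrightarrow> vars \<phi> \<inter> Y = {} \<Longrightarrow> sat_all B Y b \<phi> \<Longrightarrow> sat_all A Y a \<phi>"
proof -
  define \<Gamma> where "\<Gamma> = {\<phi>\<in>\<Phi>. sat_all A Y a \<phi>}"
  define \<Psi> where "\<Psi> = insert Bot {\<phi>\<in>\<Phi>. vars \<phi> \<inter> Y = {} \<and> \<not> sat_all A Y a \<phi>}"
  define Q where "Q = Y \<inter> (\<Union>\<gamma>\<in>\<Gamma>. vars \<gamma>)"
  have finite: "finite \<Gamma>" "finite \<Psi>" "finite Q"
    using fin by (simp_all add: \<Gamma>_def \<Psi>_def Q_def)
  have Q: "vars \<gamma> \<inter> Q = vars \<gamma> \<inter> Y" if "\<gamma> \<in> \<Gamma>" for \<gamma>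
    using that by (auto simp: Q_def)
  have "\<exists>B\<in>K. \<exists>v. refutes B v \<Gamma> Q {\<psi>}" if \<psi>: "\<psi> \<in> \<Psi>" for \<psi>
  proof (rule refuted_in_class[OF A(2)])
    show "(\<Gamma>, Q, \<psi>) \<in> pi2_rules"
      using \<psi> finite by (auto simp: pi2_rules_def \<Psi>_def Q_def)
    have "sat_all A Q a \<gamma>" if "\<gamma> \<in> \<Gamma>" for \<gamma>
      using sat_all_bound_cong[OF a Q[OF that]] that by (simp add: \<Gamma>_def)
    moreover have "eval A a \<psi> \<noteq> one A"
      using \<psi> A(1) sat_all_no_bound[OF a, of \<psi> Y] by (auto simp: \<Psi>_def nondegenerate_def)
    ultimately show "refutes A a \<Gamma> Q {\<psi>}"
      using a by (simp add: refutes_def)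
  qed
  moreover have "\<Psi> \<noteq> {}"
    by (simp add: \<Psi>_def)
  ultimately obtain B b where B: "B \<in> K" and "refutes B b \<Gamma> Q \<Psi>"
    using joint_refutation[OF finite(2)] by metis
  then have b: "b \<in> valuations B" and \<Gamma>: "\<And>\<gamma>. \<gamma> \<in> \<Gamma> \<Longrightarrow> sat_all B Q b \<gamma>"
    and \<Psi>: "\<And>\<psi>. \<psi> \<in> \<Psi> \<Longrightarrow> eval B b \<psi> \<noteq> one B"
    by (simp_all add: refutes_def)
  show thesis
  proof (rule that[OF B b])
    show "sat_all B Y b \<phi>" if "\<phi> \<in> \<Phi>" "sat_all A Y a \<phi>" for \<phi>
      using \<Gamma>[of \<phi>] sat_all_bound_cong[OF b Q] that by (simp add: \<Gamma>_def)
    show "sat_all A Y a \<phi>" if "\<phi> \<in> \<Phi>" "vars \<phi> \<inter> Y = {}" "sat_all B Y b \<phi>" for \<phi>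
      using \<Psi>[of \<phi>] sat_all_no_bound[OF b that(2)] that by (auto simp: \<Psi>_def)
  qed
qed

lemma ex_local_embedding:
  assumes A: "heyting_algebra A" "nondegenerate A" "\<And>R. R \<in> Pi2 K \<Longrightarrow> valid A R"
  shows "\<exists>B\<in>K. \<exists>h. local_embedding bs \<Phi> h A B"
proof -
  let ?a = "parameter_valuation A bs" and ?odd = "{k. odd k}"
  have a: "?a \<in> valuations A"
    using A(1) by (simp add: parameter_valuation_valuations)
  obtain B b where B: "B \<in> K" and b: "b \<in> valuations B"
    and preserves: "\<And>\<phi>. \<phi> \<in> set \<Phi> \<Longrightarrow> sat_all A ?odd ?a \<phi> \<Longrightarrow> sat_all B ?odd b \<phi>"
    and reflects: "\<And>\<phi>. \<phi> \<in> set \<Phi> \<Longrightarrow> vars \<phi> \<inter> ?odd = {} \<Longrightarrow> sat_all B ?odd b \<phi> \<Longrightarrow>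
      sat_all A ?odd ?a \<phi>"
    using finite_diagram_realized[OF A(2,3) a, of "set \<Phi>" ?odd] by blast
  define h where "h x = b (2 * inv_into {..<length bs} ((!) bs) x)" for x
  have h: "h x \<in> carr B" for x
    using b by (simp add: h_def)
  have "(sat_all A X v \<phi> \<longrightarrow> sat_all B X (h \<circ> v) \<phi>) \<and>
      (X = {} \<longrightarrow> sat_all B X (h \<circ> v) \<phi> \<longrightarrow> sat_all A X v \<phi>)"
    if v: "v \<in> valuations A" and expr: "expressible bs \<Phi> X v \<phi>" for v X \<phi>
  proof -
    let ?\<phi> = "name_parameters bs X v \<phi>"
    have "sat_all A ?odd ?a ?\<phi> \<longleftrightarrow> sat_all A X v \<phi>"
      using a v expr
      by (intro sat_all_name_parameters parameter_valuation_parameter_variable)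
        (auto simp: expressible_def)
    moreover have "sat_all B ?odd b ?\<phi> \<longleftrightarrow> sat_all B X (h \<circ> v) \<phi>"
      using b h by (intro sat_all_name_parameters)
        (auto simp: h_def parameter_variable_def valuations_iff)
    moreover have "?\<phi> \<in> set \<Phi>"
      using expr by (simp add: expressible_def)
    moreover have "vars ?\<phi> \<inter> ?odd = {}" if "X = {}"
      using that by (auto simp: name_parameters_def parameter_variable_def vars_subst)
    ultimately show ?thesis
      using preserves reflects by metis
  qed
  then show ?thesis
    using B h unfolding local_embedding_def by blast
qed

theorem axiomatized_by_Pi2:
  assumes A: "heyting_algebra A" "nondegenerate A" "\<And>R. R \<in> Pi2 K \<Longrightarrow> valid A R"
  shows "A \<in> K"
proof -
  obtain c :: "'a list \<times> fm list \<Rightarrow> 'a" where "inj c"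
    using infinite_inj_list_countable[OF infinite_UNIV] by blast
  with inj_e have "inj (e \<circ> c)"
    by (rule inj_compose)
  then obtain g :: "'a list \<times> fm list \<Rightarrow> 'i" where g: "inj g" by blast
  obtain U where U: "ultrafilter_on (range g) U"
    and expressible: "\<And>X v \<phi>. {i \<in> range g. expressible (fst (inv g i)) (snd (inv g i)) X v \<phi>} \<in> U"
    using ultrafilter_of_expressible_sentences[OF g] by blast
  have "\<forall>i. \<exists>B h. B \<in> K \<and> local_embedding (fst (inv g i)) (snd (inv g i)) h A B"
    using ex_local_embedding[OF A] by blast
  then obtain B h where B: "\<And>i. B i \<in> K"
    and h: "\<And>i. local_embedding (fst (inv g i)) (snd (inv g i)) (h i) A (B i)"
    by metis
  interpret heyting_ultraproduct "range g" U B
    using U members(1)[OF B] by unfold_locales simp_all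
  have "forall_embedding (\<lambda>a. class_of (\<lambda>i\<in>range g. h i a)) A quotient_alg"
    using h expressible
    by (intro forall_embedding_of_local_embeddings) (simp_all add: eventually_index_filter)
  then have "copy_of_forall_subalgebra A quotient_alg"
    using A(1) heyting_algebra_ultraproduct members(1)[OF B]
    by (auto simp: copy_of_forall_subalgebra_iff)
  with inductive_class U B show ?thesis
    by (rule inductive_rule_class_ultraproduct)
qed

end

section \<open>The Lindenbaum algebra of a rule system\<close>

definition theorems_of :: "pi2_rule set \<Rightarrow> fm set" where
  "theorems_of S = {\<chi>. ({}, {}, \<chi>) \<in> S}"

lemma theorems_of_cut:
  assumes S: "pi2_rule_system S" and R: "(\<Delta>, Q, \<psi>) \<in> S" and \<Delta>: "\<Delta> \<subseteq> theorems_of S"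
  shows "\<psi> \<in> theorems_of S"
proof -
  have "rule_cut S"
    using S by (simp add: pi2_rule_system_def)
  moreover have "\<forall>\<delta>\<in>\<Delta>. ({}, {}, \<delta>) \<in> S"
    using \<Delta> by (auto simp: theorems_of_def)
  moreover have "Q \<inter> ((\<Union>\<gamma>\<in>{}. vars \<gamma>) - {}) = {}" "({}, {}, \<psi>) \<in> pi2_rules"
    by (simp_all add: pi2_rules_def)
  ultimately have "({}, {}, \<psi>) \<in> S"
    using R unfolding rule_cut_def by blast
  then show ?thesis
    by (simp add: theorems_of_def)
qed

lemma pi2_rule_system_alpha_fresh:
  assumes S: "pi2_rule_system S" and R: "(\<Gamma>, Q, \<psi>) \<in> S" and V: "finite V"
  obtains f where "f ` Q \<inter> V = {}"
    "(subst (\<lambda>i. Var (if i \<in> Q then f i else i)) ` \<Gamma>, f ` Q, \<psi>) \<in> S"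
proof -
  let ?V = "V \<union> (\<Union>\<gamma>\<in>\<Gamma>. vars \<gamma>) \<union> vars \<psi>"
  have "finite ?V"
    using R S V by (auto simp: pi2_rule_system_def pi2_rules_def)
  then obtain m where m: "\<forall>k\<in>?V. k < m"
    using finite_nat_set_iff_bounded by blast
  define f where "f i = m + i" for i
  have fresh: "f ` Q \<inter> ?V = {}"
    using m by (auto simp: f_def)
  have "inj_on f Q"
    by (simp add: f_def inj_on_def)
  moreover have "f ` Q \<inter> ((\<Union>\<gamma>\<in>\<Gamma>. vars \<gamma>) - Q) = {}" "f ` Q \<inter> vars \<psi> = {}"
    using fresh by auto
  moreover have "alpha_renaming S"
    using S by (simp add: pi2_rule_system_def)
  ultimately have "(subst (\<lambda>i. Var (if i \<in> Q then f i else i)) ` \<Gamma>, f ` Q, \<psi>) \<in> S"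
    using R unfolding alpha_renaming_def by meson
  moreover have "f ` Q \<inter> V = {}"
    using fresh by auto
  ultimately show thesis
    by (intro that)
qed

text \<open>Bound variables may be renamed apart from a substitution, so every substitution can be applied
  to a rule.\<close>

lemma pi2_rule_system_instance:
  assumes S: "pi2_rule_system S" and R: "(\<Gamma>, Q, \<psi>) \<in> S"
  obtains \<rho> Q' where "\<And>i. i \<notin> Q \<Longrightarrow> \<rho> i = \<sigma> i" "(subst \<rho> ` \<Gamma>, Q', subst \<sigma> \<psi>) \<in> S"
proof -
  define W where "W = ((\<Union>\<gamma>\<in>\<Gamma>. vars \<gamma>) - Q) \<union> vars \<psi>"
  define V where "V = W \<union> (\<Union>i\<in>W. vars (\<sigma> i))"
  have "finite V"
    using R S by (auto simp: V_def W_def pi2_rule_system_def pi2_rules_def)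
  then obtain f where fresh: "f ` Q \<inter> V = {}"
    and renamed: "(subst (\<lambda>i. Var (if i \<in> Q then f i else i)) ` \<Gamma>, f ` Q, \<psi>) \<in> S"
    by (rule pi2_rule_system_alpha_fresh[OF S R])
  let ?rename = "\<lambda>i. Var (if i \<in> Q then f i else i)"
  define \<tau> where "\<tau> i = (if i \<in> f ` Q then Var i else if i \<in> W then \<sigma> i else Top)" for i
  have "bound_structurality S"
    using S by (simp add: pi2_rule_system_def)
  moreover have "\<forall>i\<in>f ` Q. \<tau> i = Var i" "\<forall>i. i \<notin> f ` Q \<longrightarrow> vars (\<tau> i) \<inter> f ` Q = {}"
    using fresh by (auto simp: \<tau>_def V_def)
  ultimately have "(subst \<tau> ` subst ?rename ` \<Gamma>, f ` Q, subst \<tau> \<psi>) \<in> S"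
    using renamed unfolding bound_structurality_def by blast
  moreover define \<rho> where "\<rho> i = (if i \<in> Q then Var (f i) else \<sigma> i)" for i
  have "subst \<tau> (subst ?rename \<gamma>) = subst \<rho> \<gamma>" if "\<gamma> \<in> \<Gamma>" for \<gamma>
    unfolding subst_subst
    by (rule subst_cong) (use fresh that in \<open>auto simp: \<tau>_def \<rho>_def V_def W_def\<close>)
  then have "subst \<tau> ` subst ?rename ` \<Gamma> = subst \<rho> ` \<Gamma>"
    by (simp add: image_image)
  moreover have "subst \<tau> \<psi> = subst \<sigma> \<psi>"
    by (rule subst_cong) (use fresh in \<open>auto simp: \<tau>_def V_def W_def\<close>)
  moreover have "\<rho> i = \<sigma> i" if "i \<notin> Q" for i
    using that by (simp add: \<rho>_def)
  ultimately show thesis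
    using that by metis
qed

locale lindenbaum =
  fixes S :: "pi2_rule set" and K :: "'a heyting set"
  assumes rule_system: "pi2_rule_system S"
    and contains_Pi2: "Pi2 K \<subseteq> S"
    and heyting: "\<And>A. A \<in> K \<Longrightarrow> heyting_algebra A"
begin

lemma theorems_of_consequence:
  assumes "finite \<Delta>" "\<Delta> \<subseteq> theorems_of S"
    and "\<And>A v. A \<in> K \<Longrightarrow> v \<in> valuations A \<Longrightarrow> \<forall>\<delta>\<in>\<Delta>. eval A v \<delta> = one A \<Longrightarrow> eval A v \<psi> = one A"
  shows "\<psi> \<in> theorems_of S"
proof (rule theorems_of_cut[OF rule_system _ assms(2)])
  have "(\<Delta>, {}, \<psi>) \<in> Pi2 K"
    using assms(1,3) by (simp add: Pi2_def pi2_rules_def valid_iff)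
  then show "(\<Delta>, {}, \<psi>) \<in> S"
    using contains_Pi2 by blast
qed

definition equivalent :: "fm \<Rightarrow> fm \<Rightarrow> bool" where
  "equivalent \<phi> \<psi> \<longleftrightarrow> Iff \<phi> \<psi> \<in> theorems_of S"

lemma equivalent_consequence:
  assumes "equivalent \<phi> \<phi>'" "equivalent \<psi> \<psi>'"
    and "\<And>A v. A \<in> K \<Longrightarrow> v \<in> valuations A \<Longrightarrow> eval A v \<phi> = eval A v \<phi>' \<Longrightarrow>
      eval A v \<psi> = eval A v \<psi>' \<Longrightarrow> eval A v \<chi> = eval A v \<chi>'"
  shows "equivalent \<chi> \<chi>'"
  unfolding equivalent_def
  by (rule theorems_of_consequence[of "{Iff \<phi> \<phi>', Iff \<psi> \<psi>'}"])
    (use assms heyting in \<open>auto simp: equivalent_def eval_Iff_eq_one\<close>)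

lemma equivalent_refl: "equivalent \<phi> \<phi>"
  unfolding equivalent_def
  by (rule theorems_of_consequence[of "{}"]) (use heyting in \<open>auto simp: eval_Iff_eq_one\<close>)

lemma equivalent_sym: "equivalent \<phi> \<psi> \<Longrightarrow> equivalent \<psi> \<phi>"
  by (rule equivalent_consequence[of \<phi> \<psi> \<phi> \<psi>]) auto

lemma equivalent_trans: "equivalent \<phi> \<psi> \<Longrightarrow> equivalent \<psi> \<chi> \<Longrightarrow> equivalent \<phi> \<chi>"
  by (rule equivalent_consequence[of \<phi> \<psi> \<psi> \<chi>]) auto

lemma equivalent_Top_iff: "equivalent \<phi> Top \<longleftrightarrow> \<phi> \<in> theorems_of S"
proof
  assume "equivalent \<phi> Top"
  then show "\<phi> \<in> theorems_of S"
    using heyting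
    by (intro theorems_of_consequence[of "{Iff \<phi> Top}"]) (auto simp: equivalent_def eval_Iff_eq_one)
next
  assume "\<phi> \<in> theorems_of S"
  then show "equivalent \<phi> Top"
    using heyting unfolding equivalent_def
    by (intro theorems_of_consequence[of "{\<phi>}"]) (auto simp: eval_Iff_eq_one)
qed

definition representative :: "fm \<Rightarrow> fm" where
  "representative \<phi> = (SOME \<psi>. equivalent \<phi> \<psi>)"

lemma equivalent_representative: "equivalent \<phi> (representative \<phi>)"
  unfolding representative_def by (rule someI) (rule equivalent_refl)

lemma representative_eq_iff: "representative \<phi> = representative \<psi> \<longleftrightarrow> equivalent \<phi> \<psi>"
proof
  assume "representative \<phi> = representative \<psi>"
  then show "equivalent \<phi> \<psi>"
    using equivalent_representative equivalent_sym equivalent_trans by metis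
next
  assume "equivalent \<phi> \<psi>"
  then have "equivalent \<phi> = equivalent \<psi>"
    using equivalent_sym equivalent_trans by blast
  then show "representative \<phi> = representative \<psi>"
    by (simp add: representative_def)
qed

lemma representative_operations:
  "representative (And (representative \<phi>) (representative \<psi>)) = representative (And \<phi> \<psi>)"
  "representative (Or (representative \<phi>) (representative \<psi>)) = representative (Or \<phi> \<psi>)"
  "representative (Imp (representative \<phi>) (representative \<psi>)) = representative (Imp \<phi> \<psi>)"
  unfolding representative_eq_iff
  by (rule equivalent_consequence[OF equivalent_representative[of \<phi>]
        equivalent_representative[of \<psi>]]; simp)+

definition lindenbaum_algebra :: "fm heyting" where
  "lindenbaum_algebra = \<lparr>carr = range representative,
     meet = \<lambda>\<phi> \<psi>. representative (And \<phi> \<psi>), join = \<lambda>\<phi> \<psi>. representative (Or \<phi> \<psi>),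
     impl = \<lambda>\<phi> \<psi>. representative (Imp \<phi> \<psi>), zero = representative Bot, one = representative Top\<rparr>"

lemma valuations_lindenbaum_algebra:
  "representative \<circ> \<sigma> \<in> valuations lindenbaum_algebra"
  "v \<in> valuations lindenbaum_algebra \<Longrightarrow> representative \<circ> v = v"
proof -
  show "representative \<circ> \<sigma> \<in> valuations lindenbaum_algebra"
    by (simp add: valuations_iff lindenbaum_algebra_def)
  have "representative (representative \<phi>) = representative \<phi>" for \<phi>
    using equivalent_representative equivalent_sym by (simp add: representative_eq_iff)
  moreover have "v i \<in> range representative" if "v \<in> valuations lindenbaum_algebra" for i
    using valuations_carr[OF that] by (simp add: lindenbaum_algebra_def)
  ultimately show "representative \<circ> v = v" if "v \<in> valuations lindenbaum_algebra"
    using that by (metis comp_apply ext imageE)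
qed

lemma eval_lindenbaum_algebra:
  "eval lindenbaum_algebra (representative \<circ> \<sigma>) \<phi> = representative (subst \<sigma> \<phi>)"
  by (induction \<phi>) (simp_all add: lindenbaum_algebra_def representative_operations)

lemma eval_lindenbaum_algebra_eq_iff:
  assumes "v \<in> valuations lindenbaum_algebra"
  shows "eval lindenbaum_algebra v s = eval lindenbaum_algebra v t \<longleftrightarrow>
    equivalent (subst v s) (subst v t)"
  using eval_lindenbaum_algebra[of v] valuations_lindenbaum_algebra(2)[OF assms]
  by (simp add: representative_eq_iff)

lemma heyting_algebra_lindenbaum_algebra: "heyting_algebra lindenbaum_algebra"
proof (rule heyting_algebraI)
  show "closed_under_operations lindenbaum_algebra"
    by (simp add: closed_under_operations_def lindenbaum_algebra_def)
  fix s t s' t' v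
  assume qi: "heyting_quasi_identity TYPE('a) (s, t) (s', t')"
    and v: "v \<in> valuations lindenbaum_algebra"
    and "eval lindenbaum_algebra v s = eval lindenbaum_algebra v t"
  then have st: "equivalent (subst v s) (subst v t)"
    by (simp add: eval_lindenbaum_algebra_eq_iff)
  have "equivalent (subst v s') (subst v t')"
  proof (rule equivalent_consequence[OF st st])
    fix A u assume "A \<in> K" "u \<in> valuations A" "eval A u (subst v s) = eval A u (subst v t)"
    then show "eval A u (subst v s') = eval A u (subst v t')"
      using heyting_quasi_identityD[OF qi heyting, of A "\<lambda>i. eval A u (v i)"] heyting
      by (simp add: eval_subst valuations_iff[of "\<lambda>i. eval A u (v i)"])
  qed
  then show "eval lindenbaum_algebra v s' = eval lindenbaum_algebra v t'"
    by (simp add: eval_lindenbaum_algebra_eq_iff[OF v])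
qed

lemma representative_eq_one_iff:
  "representative \<phi> = one lindenbaum_algebra \<longleftrightarrow> \<phi> \<in> theorems_of S"
  by (simp add: lindenbaum_algebra_def representative_eq_iff equivalent_Top_iff)

lemma nondegenerate_lindenbaum_algebra:
  "nondegenerate lindenbaum_algebra \<longleftrightarrow> Bot \<notin> theorems_of S"
  using representative_eq_one_iff[of Bot] by (simp add: nondegenerate_def lindenbaum_algebra_def)

lemma valid_lindenbaum_algebra:
  assumes "R \<in> S"
  shows "valid lindenbaum_algebra R"
proof -
  obtain \<Gamma> Q \<psi> where R: "R = (\<Gamma>, Q, \<psi>)" by (cases R)
  show ?thesis
    unfolding R valid_iff
  proof (intro ballI impI)
    fix v assume v: "v \<in> valuations lindenbaum_algebra"
      and \<Gamma>: "\<forall>\<gamma>\<in>\<Gamma>. sat_all lindenbaum_algebra Q v \<gamma>"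
    note v_eq = valuations_lindenbaum_algebra(2)[OF v]
    obtain \<rho> Q' where \<rho>: "\<And>i. i \<notin> Q \<Longrightarrow> \<rho> i = v i"
      and rule_instance: "(subst \<rho> ` \<Gamma>, Q', subst v \<psi>) \<in> S"
      using pi2_rule_system_instance[OF rule_system, of \<Gamma> Q \<psi> v] assms R by metis
    have "representative \<circ> \<rho> \<in> variants lindenbaum_algebra Q v"
      using valuations_lindenbaum_algebra(1) \<rho> v_eq by (simp add: variants_iff) (metis comp_apply)
    then have "representative (subst \<rho> \<gamma>) = one lindenbaum_algebra" if "\<gamma> \<in> \<Gamma>" for \<gamma>
      using \<Gamma> that by (simp add: sat_all_def flip: eval_lindenbaum_algebra)
    then have "subst \<rho> ` \<Gamma> \<subseteq> theorems_of S"
      by (auto simp: representative_eq_one_iff)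
    then have "subst v \<psi> \<in> theorems_of S"
      by (rule theorems_of_cut[OF rule_system rule_instance])
    then show "eval lindenbaum_algebra v \<psi> = one lindenbaum_algebra"
      using eval_lindenbaum_algebra[of v \<psi>] by (simp add: v_eq representative_eq_one_iff)
  qed
qed

end

lemma pi2_rule_system_has_model:
  fixes K :: "'a heyting set"
  assumes inf: "infinite (UNIV :: 'a set)"
    and S: "pi2_rule_system S" "Pi2 K \<subseteq> S" and K: "\<And>A. A \<in> K \<Longrightarrow> heyting_algebra A"
    and consistent: "Bot \<notin> theorems_of S"
  shows "\<exists>F :: 'a heyting. heyting_algebra F \<and> nondegenerate F \<and> (\<forall>R\<in>S. valid F R)"
proof -
  interpret lindenbaum S K
    using S K by unfold_locales
  obtain c :: "'a list \<times> fm \<Rightarrow> 'a" where "inj c"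
    using infinite_inj_list_countable[OF inf] by blast
  then have "inj (\<lambda>\<phi>. c ([], \<phi>))"
    by (simp add: inj_def)
  then obtain F :: "'a heyting" and h where F: "heyting_algebra F"
    and h: "bij_betw h (carr F) (carr lindenbaum_algebra)" "heyting_hom h F lindenbaum_algebra"
    using isomorphic_copy[OF heyting_algebra_lindenbaum_algebra] inj_on_subset[OF _ subset_UNIV]
    unfolding isomorphic_iff by blast
  have "nondegenerate F"
    using consistent nondegenerate_lindenbaum_algebra h(2)
    by (auto simp: nondegenerate_def heyting_hom_def)
  moreover have "valid F R" if "R \<in> S" for R
  proof (rule valid_forall_embedding)
    show "forall_embedding h F lindenbaum_algebra"
      using F h by (intro isomorphism_imp_forall_embedding) simp_all
    show "valid lindenbaum_algebra R"
      using that by (rule valid_lindenbaum_algebra)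
    show "R \<in> pi2_rules"
      using that S(1) by (auto simp: pi2_rule_system_def)
  qed
  ultimately show ?thesis
    using F by blast
qed

section \<open>Inductive completeness\<close>

lemma inductive_rule_class_restrict:
  fixes K :: "'a heyting set"
  assumes K: "inductive_rule_class TYPE('i) K" and R: "R \<in> pi2_rules"
  shows "inductive_rule_class TYPE('i) {A \<in> K. valid A R}" (is "inductive_rule_class _ ?K")
proof -
  note heyting = inductive_rule_class_members(1)[OF K]
  note valid_copy = valid_copy_of_forall_subalgebra[OF _ _ _ R]
  show ?thesis
    unfolding inductive_rule_class_def
  proof (intro conjI ballI allI impI)
    fix A assume "A \<in> ?K"
    then show "godel_algebra A" "nondegenerate A"
      using inductive_rule_class_members[OF K] by auto
  next
    fix A B :: "'a heyting" assume "A \<in> ?K" "copy_of_forall_subalgebra B A"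
    then show "B \<in> ?K"
      using inductive_rule_class_copy[OF K] valid_copy heyting by blast
  next
    fix I :: "'i set" and A and B :: "'a heyting"
    assume I: "I \<noteq> {}" and A: "\<forall>i\<in>I. A i \<in> ?K"
      and B: "copy_of_forall_subalgebra B (direct_product I A)"
    have "valid (direct_product I A) R" "heyting_algebra (direct_product I A)"
      using A heyting by (auto intro!: valid_direct_product heyting_algebra_direct_product)
    then show "B \<in> ?K"
      using inductive_rule_class_product[OF K I _ B] valid_copy[OF B] A by simp
  next
    fix I :: "'i set" and U A and B :: "'a heyting"
    assume U: "ultrafilter_on I U" and A: "\<forall>i\<in>I. A i \<in> ?K"
      and B: "copy_of_forall_subalgebra B (ultraproduct I U A)"
    interpret heyting_ultraproduct I U A
      using U A heyting by unfold_locales auto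
    have "valid quotient_alg R" "heyting_algebra quotient_alg"
      using A R heyting by (auto intro!: valid_ultraproduct heyting_algebra_ultraproduct)
    then show "B \<in> ?K"
      using inductive_rule_class_ultraproduct[OF K U _ B] valid_copy[OF B] A by simp
  qed
qed

lemma valid_axiom_iff: "valid A ({}, {}, \<chi>) \<longleftrightarrow> (\<forall>v\<in>valuations A. eval A v \<chi> = one A)"
  by (simp add: valid_iff)

lemma valid_Bot_rule_iff:
  assumes A: "closed_under_operations A" "nondegenerate A"
  shows "valid A ({\<chi>}, vars \<chi>, Bot) \<longleftrightarrow> \<not> valid A ({}, {}, \<chi>)"
proof -
  have "sat_all A (vars \<chi>) v \<chi> \<longleftrightarrow> (\<forall>w\<in>valuations A. eval A w \<chi> = one A)"
    if "v \<in> valuations A" for v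
    using sat_all_bound_cong[OF that, of \<chi> "vars \<chi>" UNIV]
    by (simp add: sat_all_def variants_iff Ball_def)
  moreover have "(\<lambda>_. zero A) \<in> valuations A"
    using A(1) by (simp add: valuations_iff)
  ultimately show ?thesis
    using A(2) by (auto simp: valid_iff nondegenerate_def)
qed

lemma admissible_of_subclass:
  assumes K: "\<And>A. A \<in> K \<Longrightarrow> closed_under_operations A" and K': "K' \<subseteq> K" and R: "R \<in> Pi2 K'"
    and same_theorems: "\<And>\<chi>. ({}, {}, \<chi>) \<in> Pi2 K' \<Longrightarrow> ({}, {}, \<chi>) \<in> Pi2 K"
  shows "admissible K R"
proof -
  have "pi2_rule_system (Pi2 K')"
    using K K' by (intro pi2_rule_system_Pi2) auto
  moreover have "insert R (Pi2 K) \<subseteq> Pi2 K'"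
    using R K' by (auto simp: Pi2_def)
  ultimately have "oplus (Pi2 K) R \<subseteq> Pi2 K'"
    by (rule oplus_least)
  then show ?thesis
    using same_theorems unfolding admissible_def by blast
qed

context large_inductive_rule_class
begin

lemma Bot_not_in_Pi2:
  assumes "K \<noteq> {}"
  shows "({}, {}, Bot) \<notin> Pi2 K"
proof -
  obtain A where A: "A \<in> K"
    using assms by blast
  then have "(\<lambda>_. zero A) \<in> valuations A" "nondegenerate A"
    using members by (simp_all add: valuations_iff)
  then show ?thesis
    using A by (auto simp: Pi2_def valid_axiom_iff nondegenerate_def)
qed

lemma admissible_imp_valid_in_member:
  assumes ne: "K \<noteq> {}" and R: "R \<in> pi2_rules" and adm: "admissible K R"
  shows "\<exists>F\<in>K. valid F R"
proof -
  have "Bot \<notin> theorems_of (oplus (Pi2 K) R)"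
    using adm Bot_not_in_Pi2[OF ne] by (auto simp: admissible_def theorems_of_def)
  moreover have "pi2_rule_system (oplus (Pi2 K) R)"
    using R by (intro pi2_rule_system_oplus) (auto simp: Pi2_def)
  moreover have sup: "Pi2 K \<subseteq> oplus (Pi2 K) R" "R \<in> oplus (Pi2 K) R"
    using oplus_superset[of R "Pi2 K"] by simp_all
  ultimately obtain F :: "'a heyting" where F: "heyting_algebra F" "nondegenerate F"
    and valid: "\<forall>R'\<in>oplus (Pi2 K) R. valid F R'"
    using pi2_rule_system_has_model[OF infinite_UNIV, of "oplus (Pi2 K) R" K] members(1) by blast
  have "F \<in> K"
    by (rule axiomatized_by_Pi2[OF F]) (use valid sup(1) in blast)
  then show ?thesis
    using valid sup(2) by blast
qed

lemma minimal_imp_inductively_complete: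
  assumes ne: "K \<noteq> {}"
    and minimal: "\<And>K'. inductive_rule_class TYPE('i) K' \<Longrightarrow> K' \<noteq> {} \<Longrightarrow> K' \<subseteq> K \<Longrightarrow> K' = K"
  shows "inductively_complete K"
  unfolding inductively_complete_def
proof (intro ballI impI)
  fix R assume R: "R \<in> pi2_rules" and "admissible K R"
  then have "{A \<in> K. valid A R} \<noteq> {}"
    using admissible_imp_valid_in_member[OF ne] by blast
  then have "{A \<in> K. valid A R} = K"
    by (intro minimal inductive_rule_class_restrict[OF inductive_class R]) auto
  then show "R \<in> Pi2 K"
    using R by (auto simp: Pi2_def)
qed

text \<open>Every formula refuted in \<^term>\<open>K\<close> is refuted in a member that refutes \<^term>\<open>\<chi>\<close> as well,
  namely in a product with a member refuting \<^term>\<open>\<chi>\<close>.\<close>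

lemma admissible_Bot_rule:
  assumes \<chi>: "({}, {}, \<chi>) \<notin> Pi2 K"
  shows "admissible K ({\<chi>}, vars \<chi>, Bot)"
proof -
  let ?R = "({\<chi>}, vars \<chi>, Bot)"
  obtain B where B: "B \<in> K" "\<not> valid B ({}, {}, \<chi>)"
    using \<chi> by (auto simp: Pi2_def pi2_rules_def)
  show ?thesis
  proof (rule admissible_of_subclass)
    show "?R \<in> Pi2 {C \<in> K. valid C ?R}"
      by (simp add: Pi2_def pi2_rules_def)
    fix \<theta> assume \<theta>: "({}, {}, \<theta>) \<in> Pi2 {C \<in> K. valid C ?R}"
    have "valid C ({}, {}, \<theta>)" if "C \<in> K" for C
    proof (rule ccontr)
      assume "\<not> valid C ({}, {}, \<theta>)"
      then have "\<exists>B\<in>K. \<exists>v. refutes B v {} {} {\<psi>}" if "\<psi> \<in> {\<chi>, \<theta>}" for \<psi>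
        using B \<open>C \<in> K\<close> that by (auto simp: valid_iff_not_refutes)
      then obtain D v where D: "D \<in> K" "refutes D v {} {} {\<chi>, \<theta>}"
        using joint_refutation[of "{\<chi>, \<theta>}" "{}" "{}"] by auto
      then have "\<not> valid D ({}, {}, \<chi>)" "\<not> valid D ({}, {}, \<theta>)"
        by (auto simp: valid_axiom_iff refutes_def)
      moreover from this(1) have "valid D ?R"
        using members[OF D(1)] by (simp add: valid_Bot_rule_iff)
      ultimately show False
        using \<theta> D(1) by (auto simp: Pi2_def)
    qed
    then show "({}, {}, \<theta>) \<in> Pi2 K"
      by (simp add: Pi2_def pi2_rules_def)
  qed (use members(1) in auto)
qed

lemma inductively_complete_same_theorems:
  assumes complete: "inductively_complete K" and A: "A \<in> K" "valid A ({}, {}, \<chi>)"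
  shows "({}, {}, \<chi>) \<in> Pi2 K"
proof (rule ccontr)
  assume "({}, {}, \<chi>) \<notin> Pi2 K"
  then have "admissible K ({\<chi>}, vars \<chi>, Bot)"
    by (rule admissible_Bot_rule)
  then have "({\<chi>}, vars \<chi>, Bot) \<in> Pi2 K"
    using complete by (simp add: inductively_complete_def pi2_rules_def)
  then have "valid A ({\<chi>}, vars \<chi>, Bot)"
    using A(1) by (simp add: Pi2_def)
  then show False
    using members[OF A(1)] A(2) by (simp add: valid_Bot_rule_iff)
qed

lemma inductively_complete_imp_minimal:
  assumes complete: "inductively_complete K"
    and K': "inductive_rule_class TYPE('i) K'" "K' \<noteq> {}" "K' \<subseteq> K"
  shows "K' = K"
proof (rule subset_antisym[OF K'(3)], rule subsetI)
  fix B assume B: "B \<in> K"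
  interpret K': large_inductive_rule_class K' e
    using infinite_UNIV inj_e K'(1) by unfold_locales
  obtain A where A: "A \<in> K'"
    using K'(2) by blast
  have "R \<in> Pi2 K" if R: "R \<in> Pi2 K'" for R
  proof -
    have "admissible K R"
    proof (rule admissible_of_subclass[OF _ K'(3) R])
      fix \<chi> assume "({}, {}, \<chi>) \<in> Pi2 K'"
      then have "valid A ({}, {}, \<chi>)"
        using A by (simp add: Pi2_def)
      then show "({}, {}, \<chi>) \<in> Pi2 K"
        using inductively_complete_same_theorems[OF complete] A K'(3) by blast
    qed (use members(1) in auto)
    then show ?thesis
      using complete R by (auto simp: inductively_complete_def Pi2_def)
  qed
  then show "B \<in> K'"
    using K'.axiomatized_by_Pi2 members[OF B] B by (auto simp: Pi2_def)
qed

end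

theorem theorem7p3:
  fixes K :: "'a heyting set" and e :: "'a \<Rightarrow> 'i"
  assumes "infinite (UNIV :: 'a set)" and "inj e"
    and "inductive_rule_class TYPE('i) K" and "K \<noteq> {}"
  shows "inductively_complete K \<longleftrightarrow>
    (\<forall>K'. inductive_rule_class TYPE('i) K' \<and> K' \<noteq> {} \<and> K' \<subseteq> K \<longrightarrow> K' = K)"
proof -
  interpret large_inductive_rule_class K e
    using assms(1-3) by unfold_locales
  show ?thesis
    using inductively_complete_imp_minimal minimal_imp_inductively_complete[OF assms(4)] by blast
qed

end
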